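(* Let $0<s<2$, let $\Omega:S^1\to\mathbb{R}$ be smooth, strictly positive, with $\Omega(\theta+\pi)=\Omega(\theta)$, and let $W(\mathbf{x})=|\mathbf{x}|^{-s}\Omega(\theta)+|\mathbf{x}|^2$ on $\mathbb{R}^2$. Let $\tilde\Omega$ be the angular part of the Fourier transform of $|\mathbf{x}|^{-s}\Omega(\theta)$ (defined in the context), and assume that $\tilde\Omega$ is negative somewhere. Then $W$ is infinitesimal concave, i.e., for any $\epsilon>0$ there exists a function $\mu\in L^\infty(\mathbb{R}^2)$ such that $\int_{\mathbb{R}^2}\mu\,\mathrm{d}\mathbf{x}=0$, $\operatorname{supp}\mu\subset \mathcal{B}(0;\epsilon)$ and $E[\mu]<0$.
   Context: $S^1=[-\pi,\pi)$ is the set of angles (mod $2\pi$); $\theta$ is the angle of $\mathbf{x}\in\mathbb{R}^2\setminus\{0\}$, i.e. $\mathbf{x}/|\mathbf{x}|=(\cos\theta,\sin\theta)$. $\mathcal{B}(0;\epsilon)$ is the ball of radius $\epsilon$ centered at $0$. For a function (signed density) $\mu$, $E[\mu]=\frac12\int_{\mathbb{R}^2}\int_{\mathbb{R}^2}W(\mathbf{x}-\mathbf{y})\mu(\mathbf{y})\,\mathrm{d}\mathbf{y}\,\mu(\mathbf{x})\,\mathrm{d}\mathbf{x}$. The Fourier transform is $\mathcal{F}[f](\xi)=\int_{\mathbb{R}^2}f(\mathbf{x})e^{-2\pi i\mathbf{x}\cdot\xi}\,\mathrm{d}\mathbf{x}$ (extended to tempered distributions). Writing $\xi=|\xi|(\cos\varphi,\sin\varphi)$,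 the function $\tilde\Omega$ is defined by $\mathcal{F}[|\mathbf{x}|^{-s}\Omega(\theta)](\xi)=|\xi|^{-2+s}\tilde\Omega(\varphi)$; explicitly, $$\tilde\Omega(\varphi)=\tau_{2-s}\int_{-\pi}^{\pi}|\cos(\varphi-\theta)|^{-2+s}\Big(\Omega(\theta)-\Omega(\varphi+\tfrac{\pi}{2})\Big)\mathrm{d}\theta+c_s\,\Omega(\varphi+\tfrac{\pi}{2}),$$ with $\tau_r=(2\pi)^{-r}\Gamma(r)\cos\frac{r\pi}{2}$ and $c_s=\pi^{s-1}\frac{\Gamma((2-s)/2)}{\Gamma(s/2)}$. *)

theory Defs
  imports "HOL-Analysis.Analysis"
begin

definition dir_deriv :: "'a::real_normed_vector \<Rightarrow> ('a \<Rightarrow> 'b::real_normed_vector) \<Rightarrow> 'a \<Rightarrow> 'b" where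
  "dir_deriv v f x = frechet_derivative f (at x) v"

text \<open>For a list of basis vectors this is a partial derivative of order
  \<open>length vs\<close>; on the domain \<open>real\<close>, where \<open>Basis = {1}\<close>, it is the ordinary derivative of
  that order.\<close>

definition iter_deriv :: "'a::real_normed_vector list \<Rightarrow> ('a \<Rightarrow> 'b::real_normed_vector) \<Rightarrow> 'a \<Rightarrow> 'b" where
  "iter_deriv vs f = foldr dir_deriv vs f"

definition smooth :: "('a::euclidean_space \<Rightarrow> 'b::real_normed_vector) \<Rightarrow> bool" where
  "smooth f \<longleftrightarrow> (\<forall>vs. set vs \<subseteq> Basis \<longrightarrow> (\<forall>x. iter_deriv vs f differentiable (at x)))"

definition schwartz :: "('a::euclidean_space \<Rightarrow> complex) \<Rightarrow> bool" where
  "schwartz f \<longleftrightarrow> smooth f \<and>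
     (\<forall>vs k. set vs \<subseteq> Basis \<longrightarrow> bounded (range (\<lambda>x. norm x ^ k *\<^sub>R iter_deriv vs f x)))"

definition fourier :: "('a::euclidean_space \<Rightarrow> complex) \<Rightarrow> 'a \<Rightarrow> complex" where
  "fourier f \<xi> =
     (LINT x|lborel. f x * exp (- (2 * complex_of_real pi * \<i> * complex_of_real (x \<bullet> \<xi>))))"

text \<open>A function \<open>u\<close> whose products with Schwartz functions are integrable is identified with the
  tempered distribution sending \<open>f\<close> to the integral of \<open>u f\<close>.\<close>

definition tempered :: "('a::euclidean_space \<Rightarrow> complex) \<Rightarrow> bool" where
  "tempered u \<longleftrightarrow> (\<forall>f. schwartz f \<longrightarrow> integrable lborel (\<lambda>x. u x * f x))"

text \<open>The Fourier transform of the tempered distribution \<open>u\<close> is \<open>v\<close>, that is,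
  \<open>\<langle>v, f\<rangle> = \<langle>u, fourier f\<rangle>\<close> for all Schwartz functions \<open>f\<close>.\<close>

definition has_distr_fourier ::
    "('a::euclidean_space \<Rightarrow> complex) \<Rightarrow> ('a \<Rightarrow> complex) \<Rightarrow> bool" where
  "has_distr_fourier u v \<longleftrightarrow> tempered u \<and> tempered v \<and>
     (\<forall>f. schwartz f \<longrightarrow>
        (LINT \<xi>|lborel. v \<xi> * f \<xi>) = (LINT x|lborel. u x * fourier f x))"

text \<open>Functions on the circle are represented by \<open>2 * pi\<close>-periodic functions of a real variable, so
  that it is immaterial that \<open>Arg\<close> takes its values in the interval from \<open>- pi\<close> (excluded) to \<open>pi\<close>
  (included).\<close>

definition angle :: "real ^ 2 \<Rightarrow> real" where
  "angle x = Arg (Complex (x $ 1) (x $ 2))"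

text \<open>The function \<open>|x| ^ a * \<Omega>(\<theta>)\<close>. At the origin it takes the value \<open>0\<close>, because
  \<open>0 powr a = 0\<close>; this affects none of the integrals below.\<close>

definition homogeneous :: "real \<Rightarrow> (real \<Rightarrow> real) \<Rightarrow> real ^ 2 \<Rightarrow> real" where
  "homogeneous a \<Omega> x = norm x powr a * \<Omega> (angle x)"

definition potential :: "real \<Rightarrow> (real \<Rightarrow> real) \<Rightarrow> real ^ 2 \<Rightarrow> real" where
  "potential s \<Omega> x = homogeneous (- s) \<Omega> x + (norm x)\<^sup>2"

text \<open>\<open>\<Omega>t\<close> is the angular part of the Fourier transform of \<open>|x| ^ (- s) * \<Omega>(\<theta>)\<close>. The distributional
  identity alone determines \<open>\<Omega>t\<close> only almost everywhere; continuity selects the unique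
  representative with meaningful pointwise values.\<close>

definition angular_fourier :: "real \<Rightarrow> (real \<Rightarrow> real) \<Rightarrow> (real \<Rightarrow> real) \<Rightarrow> bool" where
  "angular_fourier s \<Omega> \<Omega>t \<longleftrightarrow>
     continuous_on UNIV \<Omega>t \<and> (\<forall>\<phi>. \<Omega>t (\<phi> + 2 * pi) = \<Omega>t \<phi>) \<and>
     has_distr_fourier (\<lambda>x. complex_of_real (homogeneous (- s) \<Omega> x))
                       (\<lambda>\<xi>. complex_of_real (homogeneous (- 2 + s) \<Omega>t \<xi>))"

definition energy :: "(real ^ 2 \<Rightarrow> real) \<Rightarrow> (real ^ 2 \<Rightarrow> real) \<Rightarrow> real" where
  "energy W \<mu> = 1 / 2 * (LINT x|lborel. (LINT y|lborel. W (x - y) * \<mu> y) * \<mu> x)"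

definition L_infinity :: "(real ^ 2 \<Rightarrow> real) \<Rightarrow> bool" where
  "L_infinity \<mu> \<longleftrightarrow> \<mu> \<in> borel_measurable lborel \<and> (\<exists>C. AE x in lborel. \<bar>\<mu> x\<bar> \<le> C)"

definition infinitesimal_concave :: "(real ^ 2 \<Rightarrow> real) \<Rightarrow> bool" where
  "infinitesimal_concave W \<longleftrightarrow>
     (\<forall>\<epsilon>>0. \<exists>\<mu>. L_infinity \<mu> \<and> (LINT x|lborel. \<mu> x) = 0 \<and>
        closure {x. \<mu> x \<noteq> 0} \<subseteq> ball 0 \<epsilon> \<and> energy W \<mu> < 0)"

end

theory Submission
  imports Defs "HOL-Probability.Characteristic_Functions"
begin

text \<open>
  Write \<open>K(x) = |x|\<^sup>-\<^sup>s \<Omega>(\<theta>)\<close> and let \<open>v\<close> be its Fourier transform. By Parseval the energy of a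
  density \<open>\<mu>\<close> under the kernel \<open>K\<close> is half the integral of \<open>v\<close> against the squared modulus of the
  Fourier transform of \<open>\<mu>\<close>. As \<open>v\<close> is homogeneous with a continuous angular part that is negative
  somewhere, it is negative near some frequency \<open>k\<close>, and a density oscillating with frequency close to
  \<open>k\<close> should have negative energy.

  For a Gaussian modulated with frequency \<open>k\<close> this can be made rigorous without any inversion
  formula: both the squared modulus of its transform and its autocorrelation are explicit Gaussians,
  up to a character. Inserting the Gaussian at \<open>k\<close> as a test function in the identity that
  characterises \<open>v\<close> (lemma \<open>modulated_gaussian_negative\<close>) and computing the autocorrelation
  directly (lemma \<open>gaussian_has_interaction\<close>) shows that the real or the imaginary part of the
  modulated Gaussian has negative energy under \<open>K\<close>.

  The remaining requirements are met by successive modifications that keep the energy negative.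
  \<^item> A cut-off at a large radius gives bounded support, by dominated convergence
    (lemma \<open>exists_test_density_interaction_negative\<close>).
  \<^item> Subtracting a far translate gives total mass zero; the mutual interaction of the two copies is
    negligible because \<open>K\<close> tends to \<open>0\<close> at infinity, which is where \<open>s > 0\<close> enters
    (lemma \<open>exists_neutral_test_density_interaction_negative\<close>).
  \<^item> A dilation shrinks the support into a given ball; by homogeneity it multiplies the energy under
    \<open>K\<close> by a positive factor. The quadratic part of the potential contributes minus the square of the
    first moment, once the total mass vanishes (lemma \<open>interaction_norm_square_nonpos\<close>), so it can
    only help (lemma \<open>infinitesimal_concave_homogeneous_plus_square\<close>).
\<close>

section \<open>Gaussians are Schwartz functions\<close>

lemma real_polynomial_function_has_derivative:
  fixes p :: "'a::real_normed_vector \<Rightarrow> real"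
  assumes "real_polynomial_function p"
  shows "\<exists>D. (\<forall>x. (p has_derivative D x) (at x)) \<and> (\<forall>v. real_polynomial_function (\<lambda>x. D x v))"
  using assms
proof induction
  case (linear f)
  then have "(f has_derivative f) (at x)" for x
    by (rule bounded_linear_imp_has_derivative)
  then show ?case by (intro exI[of _ "\<lambda>x. f"]) auto
next
  case (const c)
  then show ?case by (intro exI[of _ "\<lambda>x v. 0"]) auto
next
  case (add f g)
  then obtain F G where "\<And>x. (f has_derivative F x) (at x)" "\<And>x. (g has_derivative G x) (at x)"
    "\<And>v. real_polynomial_function (\<lambda>x. F x v)" "\<And>v. real_polynomial_function (\<lambda>x. G x v)"
    by blast
  then show ?case
    by (intro exI[of _ "\<lambda>x v. F x v + G x v"]) (auto intro!: derivative_intros)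
next
  case (mult f g)
  then obtain F G where "\<And>x. (f has_derivative F x) (at x)" "\<And>x. (g has_derivative G x) (at x)"
    "\<And>v. real_polynomial_function (\<lambda>x. F x v)" "\<And>v. real_polynomial_function (\<lambda>x. G x v)"
    by blast
  with mult.hyps show ?case
    by (intro exI[of _ "\<lambda>x v. f x * G x v + F x v * g x"])
       (auto intro!: real_polynomial_function.intros(3,4) has_derivative_mult)
qed

lemma real_polynomial_function_growth:
  fixes p :: "'a::real_normed_vector \<Rightarrow> real"
  assumes "real_polynomial_function p"
  shows "\<exists>C n. \<forall>x. \<bar>p x\<bar> \<le> C * (1 + norm x) ^ n"
  using assms
proof induction
  case (linear f)
  then obtain C where C: "\<And>x. norm (f x) \<le> norm x * C" "0 \<le> C"
    using bounded_linear.nonneg_bounded by blast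
  have "\<bar>f x\<bar> \<le> C * (1 + norm x) ^ 1" for x
    using C(1)[of x] C(2) by (simp add: algebra_simps)
  then show ?case by blast
next
  case (const c)
  show ?case by (intro exI[of _ "\<bar>c\<bar>"] exI[of _ 0]) auto
next
  case (add f g)
  then obtain C D m n where f: "\<And>x. \<bar>f x\<bar> \<le> C * (1 + norm x) ^ m"
    and g: "\<And>x. \<bar>g x\<bar> \<le> D * (1 + norm x) ^ n" by blast
  have "0 \<le> C" "0 \<le> D" using order_trans[OF abs_ge_zero f[of 0]] order_trans[OF abs_ge_zero g[of 0]] by auto
  have "\<bar>f x + g x\<bar> \<le> (C + D) * (1 + norm x) ^ (m + n)" for x
  proof -
    have "C * (1 + norm x) ^ m \<le> C * (1 + norm x) ^ (m + n)" "D * (1 + norm x) ^ n \<le> D * (1 + norm x) ^ (m + n)"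
      using \<open>0 \<le> C\<close> \<open>0 \<le> D\<close> by (auto intro!: mult_left_mono power_increasing)
    with f[of x] g[of x] show ?thesis by (simp add: distrib_right)
  qed
  then show ?case by blast
next
  case (mult f g)
  then obtain C D m n where f: "\<And>x. \<bar>f x\<bar> \<le> C * (1 + norm x) ^ m"
    and g: "\<And>x. \<bar>g x\<bar> \<le> D * (1 + norm x) ^ n" by blast
  have "\<bar>f x * g x\<bar> \<le> (C * D) * (1 + norm x) ^ (m + n)" for x
    using mult_mono[OF f[of x] g[of x]] order_trans[OF abs_ge_zero f[of x]]
    by (simp add: abs_mult power_add mult_ac)
  then show ?case by blast
qed

text \<open>The power is at most \<open>n! exp (1 + |x|)\<close>, and completing the square shows that
  \<open>|x - k| - c |x - k|\<^sup>2\<close> never exceeds \<open>1 / (4 c)\<close>.\<close>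

lemma one_plus_norm_power_gaussian_bounded:
  fixes k :: "'a::real_normed_vector"
  assumes "0 < c"
  shows "\<exists>B. \<forall>x. (1 + norm x) ^ n * exp (- c * (norm (x - k))\<^sup>2) \<le> B"
proof -
  have "(1 + norm x) ^ n * exp (- c * (norm (x - k))\<^sup>2)
      \<le> fact n * exp (1 + norm k + 1 / (4 * c))" for x
  proof -
    have "(1 + norm x) ^ n /\<^sub>R fact n \<le> exp (1 + norm x)"
    proof -
      have "(\<Sum>i\<in>{n}. (1 + norm x) ^ i /\<^sub>R fact i) \<le> exp (1 + norm x)"
        unfolding exp_def by (rule sum_le_suminf) (auto intro: summable_exp)
      then show ?thesis by simp
    qed
    then have "(1 + norm x) ^ n \<le> fact n * exp (1 + norm x)"
      by (simp add: field_simps)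
    moreover have "1 + norm x - c * (norm (x - k))\<^sup>2 \<le> 1 + norm k + 1 / (4 * c)"
    proof -
      have "norm x \<le> norm k + norm (x - k)"
        by (metis add.commute norm_triangle_sub)
      moreover have "norm (x - k) - c * (norm (x - k))\<^sup>2 = 1 / (4 * c) - c * (norm (x - k) - 1 / (2 * c))\<^sup>2"
        using assms by (simp add: power2_eq_square field_simps)
      moreover have "0 \<le> c * (norm (x - k) - 1 / (2 * c))\<^sup>2" using assms by simp
      ultimately show ?thesis by linarith
    qed
    ultimately have "(1 + norm x) ^ n * exp (- c * (norm (x - k))\<^sup>2)
        \<le> fact n * exp (1 + norm x) * exp (- c * (norm (x - k))\<^sup>2)"
      by (intro mult_right_mono) auto
    also have "\<dots> = fact n * exp (1 + norm x - c * (norm (x - k))\<^sup>2)"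
      by (simp add: mult_exp_exp)
    also have "\<dots> \<le> fact n * exp (1 + norm k + 1 / (4 * c))"
      using \<open>1 + norm x - _ \<le> _\<close> by simp
    finally show ?thesis .
  qed
  then show ?thesis by blast
qed

text \<open>The functions \<open>p(x) exp (- c |x - k|\<^sup>2)\<close> with a polynomial \<open>p\<close> are closed under directional
  derivatives. This is what makes the Gaussian accessible to an induction on the order of the
  derivative.\<close>

lemma polynomial_gaussian_has_derivative:
  fixes k v :: "'a::euclidean_space"
  assumes "real_polynomial_function p"
  shows "\<exists>q. real_polynomial_function q \<and>
    (\<lambda>x. complex_of_real (p x * exp (- c * (norm (x - k))\<^sup>2))) differentiable at x \<and>
    dir_deriv v (\<lambda>x. complex_of_real (p x * exp (- c * (norm (x - k))\<^sup>2)))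
      = (\<lambda>x. complex_of_real (q x * exp (- c * (norm (x - k))\<^sup>2)))"
proof -
  obtain D where D: "\<And>x. (p has_derivative D x) (at x)" "\<And>v. real_polynomial_function (\<lambda>x. D x v)"
    using real_polynomial_function_has_derivative[OF assms] by blast
  let ?G = "\<lambda>x. complex_of_real (p x * exp (- c * (norm (x - k))\<^sup>2))"
  have "((\<lambda>x. p x * exp (- c * ((x - k) \<bullet> (x - k)))) has_derivative
      (\<lambda>v. (D x v - 2 * c * p x * ((x - k) \<bullet> v)) * exp (- c * ((x - k) \<bullet> (x - k))))) (at x)" for x
    by (rule has_derivative_eq_rhs, (rule derivative_intros D)+)
       (auto simp: fun_eq_iff algebra_simps inner_commute)
  then have der: "(?G has_derivative
      (\<lambda>v. complex_of_real ((D x v - 2 * c * p x * ((x - k) \<bullet> v)) * exp (- c * (norm (x - k))\<^sup>2)))) (at x)" for x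
    unfolding power2_norm_eq_inner by (rule has_derivative_of_real)
  have "real_polynomial_function (\<lambda>x. D x v - 2 * c * p x * ((x - k) \<bullet> v))"
  proof -
    have "real_polynomial_function (\<lambda>x. x \<bullet> v)"
      by (rule real_polynomial_function.intros(1)) (rule bounded_linear_inner_left)
    then show ?thesis unfolding inner_diff_left
      by (intro real_polynomial_function_diff real_polynomial_function.intros(4) D assms
          real_polynomial_function.intros(2))
  qed
  moreover have "?G differentiable at x"
    using der by (auto simp: differentiable_def)
  moreover have "dir_deriv v ?G = (\<lambda>x. complex_of_real ((D x v - 2 * c * p x * ((x - k) \<bullet> v)) * exp (- c * (norm (x - k))\<^sup>2)))"
    by (rule ext) (simp only: dir_deriv_def frechet_derivative_at[OF der, symmetric])
  ultimately show ?thesis by blast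
qed

lemma schwartz_gaussian:
  fixes k :: "'a::euclidean_space"
  assumes "0 < c"
  shows "schwartz (\<lambda>x. complex_of_real (exp (- c * (norm (x - k))\<^sup>2)))"
proof -
  let ?G = "\<lambda>p x. complex_of_real (p x * exp (- c * (norm (x - k))\<^sup>2))"
  have iter: "\<exists>q. real_polynomial_function q \<and> iter_deriv vs (?G (\<lambda>x. 1)) = ?G q" for vs
  proof (induction vs)
    case Nil
    show ?case by (intro exI[of _ "\<lambda>x. 1"]) (auto simp: iter_deriv_def)
  next
    case (Cons v vs)
    then obtain q where q: "real_polynomial_function q" "iter_deriv vs (?G (\<lambda>x. 1)) = ?G q"
      by blast
    have "iter_deriv (v # vs) (?G (\<lambda>x. 1)) = dir_deriv v (?G q)"
      using q(2) by (simp add: iter_deriv_def)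
    then show ?case
      using polynomial_gaussian_has_derivative[OF q(1), of c k undefined v] by auto
  qed
  have "smooth (?G (\<lambda>x. 1))"
    unfolding smooth_def
  proof (intro allI impI)
    fix vs :: "'a list" and x
    obtain q where "real_polynomial_function q" "iter_deriv vs (?G (\<lambda>x. 1)) = ?G q"
      using iter by blast
    then show "iter_deriv vs (?G (\<lambda>x. 1)) differentiable at x"
      using polynomial_gaussian_has_derivative[of q c k x] by auto
  qed
  moreover have "bounded (range (\<lambda>x. norm x ^ n *\<^sub>R iter_deriv vs (?G (\<lambda>x. 1)) x))" for n vs
  proof -
    obtain q where q: "real_polynomial_function q" "iter_deriv vs (?G (\<lambda>x. 1)) = ?G q"
      using iter by blast
    obtain C m where C: "\<And>x. \<bar>q x\<bar> \<le> C * (1 + norm x) ^ m"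
      using real_polynomial_function_growth[OF q(1)] by blast
    obtain B where B: "\<And>x. (1 + norm x) ^ (n + m) * exp (- c * (norm (x - k))\<^sup>2) \<le> B"
      using one_plus_norm_power_gaussian_bounded[OF assms] by blast
    have "C \<ge> 0" using order_trans[OF abs_ge_zero C[of 0]] by simp
    have "norm (norm x ^ n *\<^sub>R ?G q x) \<le> C * B" for x
    proof -
      have "norm (norm x ^ n *\<^sub>R ?G q x) = norm x ^ n * \<bar>q x\<bar> * exp (- c * (norm (x - k))\<^sup>2)"
        by (simp add: norm_mult abs_mult)
      also have "\<dots> \<le> (1 + norm x) ^ n * (C * (1 + norm x) ^ m) * exp (- c * (norm (x - k))\<^sup>2)"
        by (intro mult_right_mono mult_mono C power_mono) auto
      also have "\<dots> = C * ((1 + norm x) ^ (n + m) * exp (- c * (norm (x - k))\<^sup>2))"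
        by (simp add: power_add)
      also have "\<dots> \<le> C * B" by (rule mult_left_mono[OF B \<open>C \<ge> 0\<close>])
      finally show ?thesis .
    qed
    then show ?thesis unfolding q(2) bounded_iff by blast
  qed
  ultimately show ?thesis unfolding schwartz_def by simp
qed

section \<open>The Fourier transform of a Gaussian\<close>

text \<open>The characteristic function of the standard normal distribution, rescaled by \<open>sqrt (2 c)\<close>.\<close>

lemma gaussian_fourier_real:
  fixes c u :: real
  assumes "0 < c"
  shows "has_bochner_integral lborel (\<lambda>t. complex_of_real (exp (- c * t\<^sup>2)) * iexp (u * t))
     (complex_of_real (sqrt (pi / c) * exp (- (u\<^sup>2 / (4 * c)))))"
proof -
  define \<sigma> where "\<sigma> = sqrt (2 * c)"
  have \<sigma>: "\<sigma> > 0" "\<sigma>\<^sup>2 = 2 * c" using assms by (auto simp: \<sigma>_def)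
  have int: "integrable lborel (\<lambda>x. std_normal_density x *\<^sub>R iexp (u / \<sigma> * x))"
    by (rule Bochner_Integration.integrable_bound[OF integrable_normal_density[of 1 0]]) auto
  have "(LINT x|lborel. std_normal_density x *\<^sub>R iexp (u / \<sigma> * x)) = char std_normal_distribution (u / \<sigma>)"
    unfolding char_def by (rule integral_density[symmetric]) auto
  also have "\<dots> = complex_of_real (exp (- (u\<^sup>2 / (4 * c))))"
    using \<sigma> by (simp add: char_std_normal_distribution power_divide)
  finally have "has_bochner_integral lborel (\<lambda>x. std_normal_density x *\<^sub>R iexp (u / \<sigma> * x))
      (complex_of_real (exp (- (u\<^sup>2 / (4 * c)))))"
    using int by (simp add: has_bochner_integral_iff)
  then have "has_bochner_integral lborel
      (\<lambda>t. std_normal_density (\<sigma> * t) *\<^sub>R iexp (u / \<sigma> * (\<sigma> * t)))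
      (complex_of_real (exp (- (u\<^sup>2 / (4 * c)))) /\<^sub>R \<sigma>)"
    using lborel_has_bochner_integral_real_affine_iff[of \<sigma>
        "\<lambda>x. std_normal_density x *\<^sub>R iexp (u / \<sigma> * x)" _ 0] \<sigma>(1)
    by (simp only: add_0 abs_of_pos)
  then have "has_bochner_integral lborel
      (\<lambda>t. complex_of_real (sqrt (2 * pi)) * (std_normal_density (\<sigma> * t) *\<^sub>R iexp (u / \<sigma> * (\<sigma> * t))))
      (complex_of_real (sqrt (2 * pi)) * (complex_of_real (exp (- (u\<^sup>2 / (4 * c)))) /\<^sub>R \<sigma>))"
    by (rule has_bochner_integral_mult_right)
  moreover have "complex_of_real (sqrt (2 * pi)) * (std_normal_density (\<sigma> * t) *\<^sub>R iexp (u / \<sigma> * (\<sigma> * t)))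
      = complex_of_real (exp (- c * t\<^sup>2)) * iexp (u * t)" for t
    using \<sigma> by (simp add: std_normal_density_def scaleR_conv_of_real power_mult_distrib real_sqrt_mult)
  moreover have "complex_of_real (sqrt (2 * pi)) * (complex_of_real (exp (- (u\<^sup>2 / (4 * c)))) /\<^sub>R \<sigma>)
      = complex_of_real (sqrt (pi / c) * exp (- (u\<^sup>2 / (4 * c))))"
    using assms by (simp add: \<sigma>_def scaleR_conv_of_real real_sqrt_mult real_sqrt_divide field_simps)
  ultimately show ?thesis by simp
qed

lemma has_bochner_integral_lborel_prod:
  fixes f :: "'a::euclidean_space \<Rightarrow> real \<Rightarrow> 'b::{real_normed_field,banach,second_countable_topology}"
  assumes f: "\<And>b. b \<in> Basis \<Longrightarrow> has_bochner_integral lborel (f b) (I b)"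
  shows "has_bochner_integral lborel (\<lambda>x. \<Prod>b\<in>Basis. f b (x \<bullet> b)) (\<Prod>b\<in>Basis. I b)"
proof -
  interpret product_sigma_finite "\<lambda>b::'a. lborel :: real measure"
    by standard
  have meas[measurable]: "f b \<in> borel_measurable borel" if "b \<in> Basis" for b
    using borel_measurable_has_bochner_integral[OF f[OF that]] by simp
  have int: "integrable lborel (f b)" "integral\<^sup>L lborel (f b) = I b" if "b \<in> Basis" for b
    using f[OF that] by (auto simp: has_bochner_integral_iff)
  have "has_bochner_integral (\<Pi>\<^sub>M b\<in>(Basis::'a set). lborel) (\<lambda>x. \<Prod>b\<in>Basis. f b (x b)) (\<Prod>b\<in>Basis. I b)"
    using product_integrable_prod[of "Basis :: 'a set" f] product_integral_prod[of "Basis :: 'a set" f] int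
    by (auto simp: has_bochner_integral_iff)
  then have "has_bochner_integral (\<Pi>\<^sub>M b\<in>(Basis::'a set). lborel)
      (\<lambda>x. \<Prod>b\<in>Basis. f b ((\<Sum>b\<in>Basis. x b *\<^sub>R b) \<bullet> b)) (\<Prod>b\<in>Basis. I b)"
    by (simp cong: prod.cong)
  then show ?thesis
    by (subst lborel_eq) (rule has_bochner_integral_distr; simp)
qed

text \<open>The integrand is a product of one-dimensional integrands, one for each coordinate.\<close>

lemma has_bochner_integral_gaussian_fourier:
  fixes \<xi> :: "'a::euclidean_space"
  assumes "0 < c"
  shows "has_bochner_integral lborel
     (\<lambda>x. complex_of_real (exp (- c * (norm x)\<^sup>2)) * exp (- (2 * complex_of_real pi * \<i> * complex_of_real (x \<bullet> \<xi>))))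
     (complex_of_real (sqrt (pi / c) ^ DIM('a) * exp (- (pi\<^sup>2 / c) * (norm \<xi>)\<^sup>2)))"
proof -
  let ?f = "\<lambda>b t. complex_of_real (exp (- c * t\<^sup>2)) * iexp ((- 2 * pi * (\<xi> \<bullet> b)) * t)"
  have "(\<Prod>b\<in>Basis. ?f b (x \<bullet> b)) =
      complex_of_real (exp (- c * (norm x)\<^sup>2)) * exp (- (2 * complex_of_real pi * \<i> * complex_of_real (x \<bullet> \<xi>)))" for x
  proof -
    have "(norm x)\<^sup>2 = (\<Sum>b\<in>Basis. (x \<bullet> b)\<^sup>2)"
      unfolding power2_norm_eq_inner by (simp add: euclidean_inner[of x x] power2_eq_square)
    then have "(\<Prod>b\<in>Basis. complex_of_real (exp (- c * (x \<bullet> b)\<^sup>2))) = complex_of_real (exp (- c * (norm x)\<^sup>2))"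
      by (simp add: exp_sum sum_distrib_left sum_negf[symmetric] del: of_real_exp exp_minus)
    moreover have "(\<Prod>b\<in>Basis. iexp ((- 2 * pi * (\<xi> \<bullet> b)) * (x \<bullet> b)))
        = exp (- (2 * complex_of_real pi * \<i> * complex_of_real (x \<bullet> \<xi>)))"
      by (subst exp_sum[symmetric])
         (simp_all add: euclidean_inner[of x \<xi>] sum_distrib_left sum_negf[symmetric] mult_ac)
    ultimately show ?thesis by (simp only: prod.distrib)
  qed
  moreover have "(\<Prod>b\<in>Basis. complex_of_real (sqrt (pi / c) * exp (- ((- 2 * pi * (\<xi> \<bullet> b))\<^sup>2 / (4 * c)))))
      = complex_of_real (sqrt (pi / c) ^ DIM('a) * exp (- (pi\<^sup>2 / c) * (norm \<xi>)\<^sup>2))"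
  proof -
    have *: "(norm \<xi>)\<^sup>2 = (\<Sum>b\<in>Basis. (\<xi> \<bullet> b)\<^sup>2)"
      unfolding power2_norm_eq_inner by (simp add: euclidean_inner[of \<xi> \<xi>] power2_eq_square)
    have "(- 2 * pi * (\<xi> \<bullet> b))\<^sup>2 / (4 * c) = pi\<^sup>2 / c * (\<xi> \<bullet> b)\<^sup>2" for b
      using assms by (simp add: power2_eq_square)
    then have "(\<Prod>b\<in>Basis. exp (- ((- 2 * pi * (\<xi> \<bullet> b))\<^sup>2 / (4 * c)))) = exp (- (pi\<^sup>2 / c) * (norm \<xi>)\<^sup>2)"
      unfolding * by (subst exp_sum[symmetric]) (simp_all add: sum_distrib_left sum_negf[symmetric])
    then show ?thesis
      by (simp only: of_real_prod[symmetric] prod.distrib) simp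
  qed
  ultimately show ?thesis
    using has_bochner_integral_lborel_prod[of ?f, OF gaussian_fourier_real[OF assms]]
    by simp
qed

lemma has_bochner_integral_translation:
  fixes f :: "'a::euclidean_space \<Rightarrow> 'b::{banach,second_countable_topology}"
  assumes "has_bochner_integral lborel f I"
  shows "has_bochner_integral lborel (\<lambda>x. f (a + x)) I"
proof -
  have m: "f \<in> borel_measurable borel" 
    using borel_measurable_has_bochner_integral[OF assms] by simp
  have p: "(+) a \<in> lborel \<rightarrow>\<^sub>M borel" by simp
  have "has_bochner_integral (distr lborel borel ((+) a)) f I"
    unfolding lborel_distr_plus by (rule assms)
  then show ?thesis
    unfolding has_bochner_integral_iff integrable_distr_eq[OF p m] integral_distr[OF p m] .
qed

lemma fourier_gaussian:
  fixes k \<xi> :: "'a::euclidean_space"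
  assumes "0 < c"
  shows "fourier (\<lambda>x. complex_of_real (exp (- c * (norm (x - k))\<^sup>2))) \<xi> =
    complex_of_real (sqrt (pi / c) ^ DIM('a) * exp (- (pi\<^sup>2 / c) * (norm \<xi>)\<^sup>2)) *
      exp (- (2 * complex_of_real pi * \<i> * complex_of_real (k \<bullet> \<xi>)))"
proof -
  have "has_bochner_integral lborel
     (\<lambda>x. (complex_of_real (exp (- c * (norm (- k + x))\<^sup>2)) * exp (- (2 * complex_of_real pi * \<i> * complex_of_real ((- k + x) \<bullet> \<xi>))))
       * exp (- (2 * complex_of_real pi * \<i> * complex_of_real (k \<bullet> \<xi>))))
     (complex_of_real (sqrt (pi / c) ^ DIM('a) * exp (- (pi\<^sup>2 / c) * (norm \<xi>)\<^sup>2)) *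
       exp (- (2 * complex_of_real pi * \<i> * complex_of_real (k \<bullet> \<xi>))))"
    by (rule has_bochner_integral_mult_left)
       (rule has_bochner_integral_translation[OF has_bochner_integral_gaussian_fourier[OF assms]])
  moreover have "(complex_of_real (exp (- c * (norm (- k + x))\<^sup>2)) * exp (- (2 * complex_of_real pi * \<i> * complex_of_real ((- k + x) \<bullet> \<xi>))))
       * exp (- (2 * complex_of_real pi * \<i> * complex_of_real (k \<bullet> \<xi>)))
     = complex_of_real (exp (- c * (norm (x - k))\<^sup>2)) * exp (- (2 * complex_of_real pi * \<i> * complex_of_real (x \<bullet> \<xi>)))" for x
  proof -
    have "- (2 * complex_of_real pi * \<i> * complex_of_real ((- k + x) \<bullet> \<xi>)) + - (2 * complex_of_real pi * \<i> * complex_of_real (k \<bullet> \<xi>))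
        = - (2 * complex_of_real pi * \<i> * complex_of_real (x \<bullet> \<xi>))"
      by (simp add: inner_add_left algebra_simps)
    moreover have "- k + x = x - k" by simp
    ultimately show ?thesis by (simp only: mult.assoc mult_exp_exp)
  qed
  ultimately show ?thesis
    unfolding fourier_def by (simp only: has_bochner_integral_iff)
qed

section \<open>A modulated Gaussian of negative energy\<close>

text \<open>The normalised Gaussians at \<open>k\<close> form an approximate identity as \<open>c\<close> grows, so the average of
  \<open>v\<close> against them approaches \<open>v k\<close>. Only the sign of the average matters here, and for that no
  normalisation is needed: the negative contribution of a small ball around \<open>k\<close> is compared with
  that of the region far from \<open>k\<close>, which decays exponentially faster in \<open>c\<close>.\<close>

lemma gaussian_average_negative:
  fixes v :: "'a::euclidean_space \<Rightarrow> real"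
  assumes int: "\<And>c. 0 < c \<Longrightarrow> integrable lborel (\<lambda>x. v x * exp (- c * (norm (x - k))\<^sup>2))"
    and cont: "isCont v k" and neg: "v k < 0"
  shows "\<exists>c>0. (LINT x|lborel. v x * exp (- c * (norm (x - k))\<^sup>2)) < 0"
proof -
  define m where "m = - v k / 2"
  have "m > 0" using neg by (simp add: m_def)
  have "\<forall>\<^sub>F x in nhds k. v x < - m"
    using order_tendstoD(2)[OF cont[unfolded isCont_def tendsto_at_iff_tendsto_nhds], of "- m"] neg by (simp add: m_def)
  then obtain r where r: "r > 0" "\<And>x. dist x k < r \<Longrightarrow> v x < - m"
    unfolding eventually_nhds_metric by blast
  define I where "I = (LINT x|lborel. \<bar>v x * exp (- 1 * (norm (x - k))\<^sup>2)\<bar>)"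
  define V where "V = measure lborel (ball k (r / 2))"
  have "V > 0" unfolding V_def using r(1) content_ball_pos[of "r/2" k] by simp
  have "I \<ge> 0" unfolding I_def by simp
  \<comment> \<open>Inside the ball of radius \<open>r / 2\<close> the Gaussian with \<open>c = 1 + t\<close> is at least
    \<open>exp (- c r\<^sup>2 / 4)\<close>; beyond radius \<open>r\<close> it is at most \<open>exp (- t r\<^sup>2)\<close> times the Gaussian with
    \<open>c = 1\<close>. The quotient of these two factors is the exponential below, and it tends to \<open>0\<close>.\<close>
  have "\<exists>t. 0 < t \<and> I * exp (r\<^sup>2 / 4) * exp (- (3/4) * r\<^sup>2 * t) < m * V"
  proof -
    have "((\<lambda>t. I * exp (r\<^sup>2 / 4) * exp (- (3/4) * r\<^sup>2 * t)) \<longlongrightarrow> I * exp (r\<^sup>2 / 4) * 0) at_top"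
    proof (intro tendsto_mult_left)
      have "filterlim (\<lambda>t. (3/4) * r\<^sup>2 * t) at_top at_top"
        using r(1) by (intro filterlim_tendsto_pos_mult_at_top[OF tendsto_const]) (auto intro: filterlim_ident)
      then have "filterlim (\<lambda>t. - ((3/4) * r\<^sup>2 * t)) at_bot at_top"
        by (simp add: filterlim_uminus_at_top)
      from filterlim_compose[OF exp_at_bot this]
      show "((\<lambda>t. exp (- (3/4) * r\<^sup>2 * t)) \<longlongrightarrow> 0) at_top" by simp
    qed
    then have "\<forall>\<^sub>F t in at_top. I * exp (r\<^sup>2 / 4) * exp (- (3/4) * r\<^sup>2 * t) < m * V"
      using \<open>m > 0\<close> \<open>V > 0\<close> by (intro order_tendstoD(2)) auto
    then have "\<forall>\<^sub>F t in at_top. 0 < t \<and> I * exp (r\<^sup>2 / 4) * exp (- (3/4) * r\<^sup>2 * t) < m * V"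
      using eventually_gt_at_top[of 0] by eventually_elim auto
    then show ?thesis by (rule eventually_happens'[OF trivial_limit_at_top_linorder])
  qed
  then obtain t where t: "0 < t" "I * exp (r\<^sup>2 / 4) * exp (- (3/4) * r\<^sup>2 * t) < m * V" by blast
  define c where "c = 1 + t"
  let ?g = "\<lambda>c x. exp (- c * (norm (x - k))\<^sup>2)"
  have pt: "v x * ?g c x \<le> exp (- t * r\<^sup>2) * \<bar>v x * ?g 1 x\<bar> - m * exp (- c * (r / 2)\<^sup>2) * indicator (ball k (r/2)) x" for x
  proof (cases "dist x k < r")
    case True
    have "m * exp (- c * (r / 2)\<^sup>2) * indicator (ball k (r/2)) x \<le> m * ?g c x"
    proof (cases "dist x k < r / 2")
      case True
      then have "(norm (x - k))\<^sup>2 \<le> (r / 2)\<^sup>2" by (intro power_mono) (auto simp: dist_norm)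
      then show ?thesis using True \<open>m > 0\<close> t(1) by (auto simp: c_def indicator_def)
    next
      case False
      then show ?thesis using \<open>m > 0\<close> by (simp add: indicator_def dist_commute)
    qed
    moreover have "v x * ?g c x \<le> - m * ?g c x"
      using r(2)[OF True] by (intro mult_right_mono) auto
    moreover have "0 \<le> exp (- t * r\<^sup>2) * \<bar>v x * ?g 1 x\<bar>" by simp
    ultimately show ?thesis by linarith
  next
    case False
    then have "r\<^sup>2 \<le> (norm (x - k))\<^sup>2" using r(1) by (intro power_mono) (auto simp: dist_norm)
    then have far: "exp (- t * (norm (x - k))\<^sup>2) \<le> exp (- t * r\<^sup>2)" using t(1) by simp
    have "?g c x = exp (- t * (norm (x - k))\<^sup>2) * ?g 1 x"
      by (simp add: c_def mult_exp_exp algebra_simps)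
    then have "v x * ?g c x \<le> exp (- t * (norm (x - k))\<^sup>2) * \<bar>v x * ?g 1 x\<bar>"
      by (simp only: mult.left_commute[of "v x"]) (intro mult_left_mono abs_ge_self exp_ge_zero)
    also have "\<dots> \<le> exp (- t * r\<^sup>2) * \<bar>v x * ?g 1 x\<bar>"
      by (intro mult_right_mono abs_ge_zero far)
    finally have "v x * ?g c x \<le> exp (- t * r\<^sup>2) * \<bar>v x * ?g 1 x\<bar>" .
    moreover have "indicator (ball k (r/2)) x = (0::real)"
      using False r(1) by (auto simp: indicator_def dist_commute)
    ultimately show ?thesis by simp
  qed
  have "c > 0" using t by (simp add: c_def)
  have fin: "emeasure lborel (ball k (r/2)) < \<infinity>"
    using emeasure_lborel_ball_finite[of k "r/2"] by simp
  have int_ind: "integrable lborel (indicator (ball k (r/2)) :: 'a \<Rightarrow> real)"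
    using fin by (intro integrable_real_indicator) auto
  have "(LINT x|lborel. v x * ?g c x)
      \<le> (LINT x|lborel. exp (- t * r\<^sup>2) * \<bar>v x * ?g 1 x\<bar> - m * exp (- c * (r / 2)\<^sup>2) * indicator (ball k (r/2)) x)"
    by (intro integral_mono[OF int[OF \<open>c > 0\<close>]] pt Bochner_Integration.integrable_diff
        integrable_mult_right int_ind integrable_abs int) simp
  also have "\<dots> = exp (- t * r\<^sup>2) * I - m * exp (- c * (r / 2)\<^sup>2) * V"
    using int_ind integrable_abs[OF int[of 1]] by (subst Bochner_Integration.integral_diff) (simp_all add: I_def V_def)
  also have "\<dots> \<le> exp (- c * (r / 2)\<^sup>2) * (I * exp (r\<^sup>2 / 4) * exp (- (3/4) * r\<^sup>2 * t) - m * V)"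
  proof -
    have "exp (- t * r\<^sup>2) \<le> exp (- c * (r / 2)\<^sup>2) * (exp (r\<^sup>2 / 4) * exp (- (3/4) * r\<^sup>2 * t))"
      by (simp add: mult_exp_exp c_def power2_eq_square algebra_simps diff_divide_distrib)
    from mult_left_mono[OF this \<open>I \<ge> 0\<close>] show ?thesis by (simp add: algebra_simps)
  qed
  also have "\<dots> < 0" using t(2) by (simp add: mult_less_0_iff)
  finally show ?thesis using \<open>c > 0\<close> by blast
qed

text \<open>A Gaussian at \<open>k\<close> is used as the test function in the identity that defines \<open>v\<close> as the
  Fourier transform of \<open>K\<close>. Its own transform is a centred Gaussian times the character of frequency
  \<open>k\<close>, and the cosine is the real part of that character.\<close>

lemma modulated_gaussian_negative:
  fixes K v :: "'a::euclidean_space \<Rightarrow> real"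
  assumes F: "has_distr_fourier (\<lambda>x. complex_of_real (K x)) (\<lambda>\<xi>. complex_of_real (v \<xi>))"
    and "isCont v k" and "v k < 0"
  shows "\<exists>c>0. (LINT x|lborel. K x * cos (2 * pi * (k \<bullet> x)) * exp (- c * (norm x)\<^sup>2)) < 0"
proof -
  have "integrable lborel (\<lambda>x. v x * exp (- c * (norm (x - k))\<^sup>2))" if "0 < c" for c
  proof -
    have "integrable lborel (\<lambda>x. complex_of_real (v x) * complex_of_real (exp (- c * (norm (x - k))\<^sup>2)))"
      using F schwartz_gaussian[OF that, of k] unfolding has_distr_fourier_def tempered_def by blast
    then show ?thesis by (simp only: of_real_mult[symmetric] complex_of_real_integrable_eq)
  qed
  then obtain c where c: "0 < c" "(LINT x|lborel. v x * exp (- c * (norm (x - k))\<^sup>2)) < 0"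
    using gaussian_average_negative assms(2,3) by blast
  define C where "C = sqrt (pi / c) ^ DIM('a)"
  define H where "H x = complex_of_real (K x) *
    (complex_of_real (C * exp (- (pi\<^sup>2 / c) * (norm x)\<^sup>2)) *
      exp (- (2 * complex_of_real pi * \<i> * complex_of_real (k \<bullet> x))))" for x
  have "C > 0" using c(1) by (simp add: C_def)
  have "(LINT x|lborel. complex_of_real (v x) * complex_of_real (exp (- c * (norm (x - k))\<^sup>2))) = integral\<^sup>L lborel H"
    using F schwartz_gaussian[OF c(1), of k] unfolding has_distr_fourier_def H_def C_def
    by (simp only: fourier_gaussian[OF c(1)])
  then have eq: "complex_of_real (LINT x|lborel. v x * exp (- c * (norm (x - k))\<^sup>2)) = integral\<^sup>L lborel H"
    by (simp only: of_real_mult[symmetric] integral_complex_of_real)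
  \<comment> \<open>The integral of a function that is not integrable would be \<open>0\<close>.\<close>
  then have "integrable lborel H"
    using c(2) not_integrable_integral_eq[of lborel H] by fastforce
  then have "(LINT x|lborel. Re (H x)) = Re (integral\<^sup>L lborel H)" by (rule integral_Re)
  then have neg: "(LINT x|lborel. Re (H x)) < 0"
    using c(2) by (simp add: eq[symmetric] del: of_real_mult)
  have "Re (H x) = C * (K x * cos (2 * pi * (k \<bullet> x)) * exp (- (pi\<^sup>2 / c) * (norm x)\<^sup>2))" for x
    unfolding H_def by (simp add: Re_exp)
  then have "C * (LINT x|lborel. K x * cos (2 * pi * (k \<bullet> x)) * exp (- (pi\<^sup>2 / c) * (norm x)\<^sup>2)) < 0"
    using neg by (simp only: integral_mult_right_zero)
  then show ?thesis
    using \<open>C > 0\<close> c(1) by (intro exI[of _ "pi\<^sup>2 / c"]) (simp add: mult_less_0_iff)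
qed

section \<open>The interaction of two densities\<close>

lemma has_bochner_integral_pair_mult:
  fixes f :: "'a::euclidean_space \<Rightarrow> real" and g :: "'b::euclidean_space \<Rightarrow> real"
  assumes f: "has_bochner_integral lborel f I" and g: "has_bochner_integral lborel g J"
  shows "has_bochner_integral (lborel \<Otimes>\<^sub>M lborel) (\<lambda>p. f (fst p) * g (snd p)) (I * J)"
proof -
  have [measurable]: "f \<in> borel_measurable borel" "g \<in> borel_measurable borel"
    using borel_measurable_has_bochner_integral[OF f] borel_measurable_has_bochner_integral[OF g] by auto
  have i: "integrable lborel f" "integrable lborel g" "integral\<^sup>L lborel f = I" "integral\<^sup>L lborel g = J"
    using f g by (auto simp: has_bochner_integral_iff)
  have "integrable (lborel \<Otimes>\<^sub>M lborel) (\<lambda>p. f (fst p) * g (snd p))"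
    using i by (intro lborel_pair.Fubini_integrable) (auto simp: abs_mult)
  moreover from lborel_pair.integral_fst'[OF this]
  have "(LINT p|(lborel \<Otimes>\<^sub>M lborel). f (fst p) * g (snd p)) = I * J"
    using i by simp
  ultimately show ?thesis by (simp add: has_bochner_integral_iff)
qed

lemma nn_integral_translation:
  fixes f :: "'a::euclidean_space \<Rightarrow> ennreal"
  assumes [measurable]: "f \<in> borel_measurable borel"
  shows "(\<integral>\<^sup>+x. f (a + x) \<partial>lborel) = (\<integral>\<^sup>+x. f x \<partial>lborel)"
proof -
  have "(\<integral>\<^sup>+x. f x \<partial>lborel) = (\<integral>\<^sup>+x. f x \<partial>distr lborel borel ((+) a))"
    by (simp add: lborel_distr_plus)
  also have "\<dots> = (\<integral>\<^sup>+x. f (a + x) \<partial>lborel)" by (rule nn_integral_distr) auto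
  finally show ?thesis ..
qed

text \<open>By Tonelli, because each horizontal slice is merely translated.\<close>

lemma distr_shear_fst:
  fixes h :: "'b::euclidean_space \<Rightarrow> 'a::euclidean_space"
  assumes [measurable]: "h \<in> borel_measurable borel"
  shows "distr (lborel \<Otimes>\<^sub>M lborel) (lborel \<Otimes>\<^sub>M lborel) (\<lambda>p. (h (snd p) + fst p, snd p)) = lborel \<Otimes>\<^sub>M lborel"
proof (rule measure_eqI)
  fix A assume "A \<in> sets (distr (lborel \<Otimes>\<^sub>M lborel) (lborel \<Otimes>\<^sub>M lborel) (\<lambda>p. (h (snd p) + fst p, snd p)))"
  then have A[measurable]: "A \<in> sets (borel \<Otimes>\<^sub>M borel)"
    by (simp cong: sets_pair_measure_cong)
  have "emeasure (distr (lborel \<Otimes>\<^sub>M lborel) (lborel \<Otimes>\<^sub>M lborel) (\<lambda>p. (h (snd p) + fst p, snd p))) A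
      = (\<integral>\<^sup>+p. indicator A p \<partial>distr (lborel \<Otimes>\<^sub>M lborel) (lborel \<Otimes>\<^sub>M lborel) (\<lambda>p. (h (snd p) + fst p, snd p)))"
    by simp
  also have "\<dots> = (\<integral>\<^sup>+p. indicator A (h (snd p) + fst p, snd p) \<partial>(lborel \<Otimes>\<^sub>M lborel))"
    by (rule nn_integral_distr) measurable
  also have "\<dots> = (\<integral>\<^sup>+y. \<integral>\<^sup>+x. indicator A (h y + x, y) \<partial>lborel \<partial>lborel)"
    by (subst lborel_pair.nn_integral_snd[symmetric]) simp_all
  also have "\<dots> = (\<integral>\<^sup>+y. \<integral>\<^sup>+x. indicator A (x, y) \<partial>lborel \<partial>lborel)"
    by (intro nn_integral_cong nn_integral_translation) simp
  also have "\<dots> = (\<integral>\<^sup>+p. indicator A p \<partial>(lborel \<Otimes>\<^sub>M lborel))"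
    by (subst lborel_pair.nn_integral_snd) simp_all
  also have "\<dots> = emeasure (lborel \<Otimes>\<^sub>M lborel) A" by simp
  finally show "emeasure (distr (lborel \<Otimes>\<^sub>M lborel) (lborel \<Otimes>\<^sub>M lborel) (\<lambda>p. (h (snd p) + fst p, snd p))) A
      = emeasure (lborel \<Otimes>\<^sub>M lborel) A" .
qed simp

text \<open>The map that sends a difference and a midpoint to the two points preserves the measure: it is
  made of two shears, one of them conjugated by the exchange of the coordinates.\<close>

lemma distr_centre_difference:
  "distr (lborel \<Otimes>\<^sub>M lborel) (lborel \<Otimes>\<^sub>M lborel) (\<lambda>p. (snd p + fst p /\<^sub>R 2, snd p - fst p /\<^sub>R 2))
    = (lborel \<Otimes>\<^sub>M lborel :: ('a::euclidean_space \<times> 'a) measure)"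
proof -
  let ?L = "lborel \<Otimes>\<^sub>M lborel :: ('a \<times> 'a) measure"
  let ?W = "\<lambda>p::'a \<times> 'a. (snd p, fst p)"
  let ?S = "\<lambda>p::'a \<times> 'a. (- (snd p /\<^sub>R 2) + fst p, snd p)" and ?T = "\<lambda>p::'a \<times> 'a. (snd p + fst p, snd p)"
  have W: "distr ?L ?L ?W = ?L"
    using lborel_pair.distr_pair_swap[where 'a='a and 'b='a] by (simp add: case_prod_beta')
  have S: "distr ?L ?L ?S = ?L" and T: "distr ?L ?L ?T = ?L"
    using distr_shear_fst[of "\<lambda>x::'a. - (x /\<^sub>R 2)"] distr_shear_fst[of "\<lambda>y::'a. y"] by simp_all
  have comp: "distr ?L ?L (g \<circ> f) = ?L"
    if "distr ?L ?L f = ?L" "distr ?L ?L g = ?L" and "f \<in> ?L \<rightarrow>\<^sub>M ?L" "g \<in> ?L \<rightarrow>\<^sub>M ?L" for f g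
    using distr_distr[OF that(4,3)] that(1,2) by simp
  have m: "?W \<in> ?L \<rightarrow>\<^sub>M ?L" "?S \<in> ?L \<rightarrow>\<^sub>M ?L" "?T \<in> ?L \<rightarrow>\<^sub>M ?L"
    by measurable
  have "distr ?L ?L (?T \<circ> (?W \<circ> (?S \<circ> ?W))) = ?L"
    by (intro comp measurable_comp[of _ ?L ?L] W S T m)
  moreover have "?T \<circ> (?W \<circ> (?S \<circ> ?W)) = (\<lambda>p. (snd p + fst p /\<^sub>R 2, snd p - fst p /\<^sub>R 2))"
  proof
    fix p :: "'a \<times> 'a"
    have "fst p = fst p /\<^sub>R 2 + fst p /\<^sub>R 2" by (simp add: scaleR_left_distrib[symmetric])
    then show "(?T \<circ> (?W \<circ> (?S \<circ> ?W))) p = (snd p + fst p /\<^sub>R 2, snd p - fst p /\<^sub>R 2)"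
      by (simp add: algebra_simps)
  qed
  ultimately show ?thesis by (simp only:)
qed

text \<open>The bilinear form of the kernel \<open>K\<close>, written as a single integral over the product space, so that
  integrability is a single condition and Fubini applies to either order.\<close>

definition interaction :: "('a::euclidean_space \<Rightarrow> real) \<Rightarrow> ('a \<Rightarrow> real) \<Rightarrow> ('a \<Rightarrow> real) \<Rightarrow> real" where
  "interaction K \<mu> \<nu> = (LINT p|(lborel \<Otimes>\<^sub>M lborel). K (fst p - snd p) * (\<mu> (fst p) * \<nu> (snd p)))"

text \<open>The consequence of temperedness on which the construction of the density rests: \<open>K\<close> is measurable,
  locally integrable and, on average, grows more slowly than any \<open>exp (c |z|\<^sup>2)\<close>.\<close>

definition gaussian_integrable :: "('a::euclidean_space \<Rightarrow> real) \<Rightarrow> bool" where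
  "gaussian_integrable K \<longleftrightarrow> (\<forall>c>0. integrable lborel (\<lambda>z. K z * exp (- c * (norm z)\<^sup>2)))"

lemma gaussian_integrableD:
  "gaussian_integrable K \<Longrightarrow> 0 < c \<Longrightarrow> integrable lborel (\<lambda>z. K z * exp (- c * (norm z)\<^sup>2))"
  by (simp only: gaussian_integrable_def)

lemma gaussian_integrable_measurable:
  assumes "gaussian_integrable K"
  shows "K \<in> borel_measurable borel"
proof -
  have "(\<lambda>z. K z * exp (- 1 * (norm z)\<^sup>2)) \<in> borel_measurable lborel"
    by (intro borel_measurable_integrable gaussian_integrableD[OF assms]) simp
  then have [measurable]: "(\<lambda>z. K z * exp (- 1 * (norm z)\<^sup>2)) \<in> borel_measurable borel" by simp
  have "(\<lambda>z. K z * exp (- 1 * (norm z)\<^sup>2) * exp ((norm z)\<^sup>2)) \<in> borel_measurable borel" by measurable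
  then show ?thesis by (simp add: mult.assoc mult_exp_exp)
qed

text \<open>In the coordinates \<open>z = x - y\<close> and \<open>(x + y) / 2\<close> the parallelogram law turns the product of two
  equal Gaussians into a Gaussian in the difference times a Gaussian in the midpoint, so the double
  integral factorises.\<close>

lemma gaussian_has_interaction:
  fixes K :: "'a::euclidean_space \<Rightarrow> real"
  assumes K: "K \<in> borel_measurable borel"
    and I: "has_bochner_integral lborel (\<lambda>z. K z * exp (- c * (norm z)\<^sup>2)) I"
    and J: "has_bochner_integral lborel (\<lambda>y::'a. exp (- (4 * c) * (norm y)\<^sup>2)) J"
  shows "has_bochner_integral (lborel \<Otimes>\<^sub>M lborel)
    (\<lambda>p. K (fst p - snd p) * (exp (- (2 * c) * (norm (fst p))\<^sup>2) * exp (- (2 * c) * (norm (snd p))\<^sup>2))) (I * J)"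
proof -
  note [measurable] = K
  let ?F = "\<lambda>p::'a \<times> 'a. K (fst p - snd p) * (exp (- (2 * c) * (norm (fst p))\<^sup>2) * exp (- (2 * c) * (norm (snd p))\<^sup>2))"
  let ?T = "\<lambda>p::'a \<times> 'a. (snd p + fst p /\<^sub>R 2, snd p - fst p /\<^sub>R 2)"
  have "?F (?T p) = K (fst p) * exp (- c * (norm (fst p))\<^sup>2) * exp (- (4 * c) * (norm (snd p))\<^sup>2)" for p
  proof -
    have "fst p /\<^sub>R 2 + fst p /\<^sub>R 2 = fst p" by (simp add: scaleR_left_distrib[symmetric])
    then have 1: "fst (?T p) - snd (?T p) = fst p" by simp
    have "(norm (y + z /\<^sub>R 2))\<^sup>2 + (norm (y - z /\<^sub>R 2))\<^sup>2 = 2 * (norm y)\<^sup>2 + (norm z)\<^sup>2 / 2" for y z :: 'a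
      unfolding power2_norm_eq_inner by (simp add: inner_simps inner_commute)
    from arg_cong[OF this[of "snd p" "fst p"], of "\<lambda>r. - (2 * c) * r"]
    have 2: "exp (- (2 * c) * (norm (fst (?T p)))\<^sup>2) * exp (- (2 * c) * (norm (snd (?T p)))\<^sup>2)
        = exp (- c * (norm (fst p))\<^sup>2) * exp (- (4 * c) * (norm (snd p))\<^sup>2)"
      by (simp add: mult_exp_exp algebra_simps)
    show ?thesis unfolding 1 2 by simp
  qed
  then have "has_bochner_integral (lborel \<Otimes>\<^sub>M lborel) (\<lambda>p. ?F (?T p)) (I * J)"
    using has_bochner_integral_pair_mult[OF I J] by simp
  then have "has_bochner_integral (distr (lborel \<Otimes>\<^sub>M lborel) (lborel \<Otimes>\<^sub>M lborel) ?T) ?F (I * J)"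
    by (intro has_bochner_integral_distr) measurable
  then show ?thesis unfolding distr_centre_difference .
qed

lemma has_bochner_integral_gaussian:
  assumes "0 < c"
  shows "has_bochner_integral lborel (\<lambda>x::'a::euclidean_space. exp (- c * (norm x)\<^sup>2)) (sqrt (pi / c) ^ DIM('a))"
proof -
  have "has_bochner_integral lborel (\<lambda>x::'a. complex_of_real (exp (- c * (norm x)\<^sup>2))) (complex_of_real (sqrt (pi / c) ^ DIM('a)))"
    using has_bochner_integral_gaussian_fourier[OF assms, of "0::'a"] by simp
  then show ?thesis
    by (simp only: has_bochner_integral_iff complex_of_real_integrable_eq integral_complex_of_real of_real_eq_iff)
qed

text \<open>Densities dominated by Gaussians form a class that contains the modulated Gaussians as well as all
  bounded densities of bounded support, so the interaction is defined for both at once.\<close>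

lemma interaction_integrable:
  assumes K: "gaussian_integrable K"
    and m[measurable]: "\<mu> \<in> borel_measurable borel" "\<nu> \<in> borel_measurable borel"
    and "0 < c" and \<mu>: "\<And>x. \<bar>\<mu> x\<bar> \<le> A * exp (- c * (norm x)\<^sup>2)" and \<nu>: "\<And>x. \<bar>\<nu> x\<bar> \<le> B * exp (- c * (norm x)\<^sup>2)"
  shows "integrable (lborel \<Otimes>\<^sub>M lborel) (\<lambda>p. K (fst p - snd p) * (\<mu> (fst p) * \<nu> (snd p)))"
proof -
  note [measurable] = gaussian_integrable_measurable[OF K]
  let ?G = "\<lambda>p. K (fst p - snd p) * (exp (- c * (norm (fst p))\<^sup>2) * exp (- c * (norm (snd p))\<^sup>2))"
  have "has_bochner_integral lborel (\<lambda>z. K z * exp (- (c / 2) * (norm z)\<^sup>2)) (LINT z|lborel. K z * exp (- (c / 2) * (norm z)\<^sup>2))"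
    using \<open>0 < c\<close> by (intro has_bochner_integral_integrable gaussian_integrableD[OF K]) simp
  from gaussian_has_interaction[OF _ this has_bochner_integral_gaussian] \<open>0 < c\<close>
  have "integrable (lborel \<Otimes>\<^sub>M lborel) ?G" by (simp add: has_bochner_integral_iff)
  then have "integrable (lborel \<Otimes>\<^sub>M lborel) (\<lambda>p. (A * B) * ?G p)" by (rule integrable_mult_right)
  then show ?thesis
  proof (rule Bochner_Integration.integrable_bound)
    have prod: "\<bar>\<mu> x * \<nu> y\<bar> \<le> (A * exp (- c * (norm x)\<^sup>2)) * (B * exp (- c * (norm y)\<^sup>2))" for x y
      unfolding abs_mult using \<mu>[of x] \<nu>[of y] by (intro mult_mono) auto
    have "norm (K (fst p - snd p) * (\<mu> (fst p) * \<nu> (snd p))) \<le> norm ((A * B) * ?G p)" for p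
    proof -
      have "\<bar>K (fst p - snd p)\<bar> * \<bar>\<mu> (fst p) * \<nu> (snd p)\<bar>
        \<le> \<bar>K (fst p - snd p)\<bar> * \<bar>(A * exp (- c * (norm (fst p))\<^sup>2)) * (B * exp (- c * (norm (snd p))\<^sup>2))\<bar>"
        by (rule mult_left_mono[OF order_trans[OF prod abs_ge_self] abs_ge_zero])
      then show ?thesis by (simp add: abs_mult mult_ac)
    qed
    then show "AE p in lborel \<Otimes>\<^sub>M lborel. norm (K (fst p - snd p) * (\<mu> (fst p) * \<nu> (snd p))) \<le> norm ((A * B) * ?G p)"
      by simp
  qed measurable
qed

section \<open>Bounded densities of bounded support\<close>

definition test_density :: "real \<Rightarrow> ('a::euclidean_space \<Rightarrow> real) \<Rightarrow> bool" where
  "test_density R \<mu> \<longleftrightarrow> \<mu> \<in> borel_measurable borel \<and> (\<exists>M. \<forall>x. \<bar>\<mu> x\<bar> \<le> M) \<and> (\<forall>x. R < norm x \<longrightarrow> \<mu> x = 0)"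

lemma test_density_measurable: "test_density R \<mu> \<Longrightarrow> \<mu> \<in> borel_measurable borel"
  by (simp add: test_density_def)

lemma test_density_mono: "test_density R \<mu> \<Longrightarrow> R \<le> S \<Longrightarrow> test_density S \<mu>"
  by (simp add: test_density_def)

lemma test_density_gaussian_bound:
  assumes "test_density R \<mu>"
  shows "\<exists>A. \<forall>x. \<bar>\<mu> x\<bar> \<le> A * exp (- 1 * (norm x)\<^sup>2)"
proof -
  obtain M where M: "\<And>x. \<bar>\<mu> x\<bar> \<le> M" and R: "\<And>x. R < norm x \<Longrightarrow> \<mu> x = 0"
    using assms unfolding test_density_def by blast
  have "M \<ge> 0" using order_trans[OF abs_ge_zero M[of 0]] .
  have "\<bar>\<mu> x\<bar> \<le> M * exp (R\<^sup>2) * exp (- 1 * (norm x)\<^sup>2)" for x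
  proof (cases "R < norm x")
    case True
    then show ?thesis using R \<open>M \<ge> 0\<close> by simp
  next
    case False
    then have "(norm x)\<^sup>2 \<le> R\<^sup>2" by (intro power_mono) auto
    then have "1 \<le> exp (R\<^sup>2 - (norm x)\<^sup>2)" by simp
    from order_trans[OF _ mult_left_mono[OF this \<open>M \<ge> 0\<close>]] M[of x]
    have "\<bar>\<mu> x\<bar> \<le> M * exp (R\<^sup>2 - (norm x)\<^sup>2)" by simp
    then show ?thesis by (simp add: mult_exp_exp mult.assoc)
  qed
  then show ?thesis by blast
qed

lemma interaction_integrable_test:
  assumes "gaussian_integrable K" "test_density R \<mu>" "test_density S \<nu>"
  shows "integrable (lborel \<Otimes>\<^sub>M lborel) (\<lambda>p. K (fst p - snd p) * (\<mu> (fst p) * \<nu> (snd p)))"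
proof -
  obtain A B where "\<And>x. \<bar>\<mu> x\<bar> \<le> A * exp (- 1 * (norm x)\<^sup>2)" "\<And>x. \<bar>\<nu> x\<bar> \<le> B * exp (- 1 * (norm x)\<^sup>2)"
    using test_density_gaussian_bound assms by metis
  then show ?thesis
    using assms by (intro interaction_integrable[where c=1]) (auto simp: test_density_measurable)
qed

lemma test_density_integrable:
  fixes f :: "'a::euclidean_space \<Rightarrow> 'b::{banach,second_countable_topology}"
  assumes \<mu>: "test_density R \<mu>" and f: "continuous_on UNIV f"
  shows "integrable lborel (\<lambda>x. \<mu> x *\<^sub>R f x)"
proof -
  have [measurable]: "\<mu> \<in> borel_measurable borel" "f \<in> borel_measurable borel"
    using test_density_measurable[OF \<mu>] borel_measurable_continuous_onI[OF f] by auto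
  obtain M where M: "\<And>x. \<bar>\<mu> x\<bar> \<le> M" and R: "\<And>x. R < norm x \<Longrightarrow> \<mu> x = 0"
    using \<mu> unfolding test_density_def by blast
  have "integrable lborel (\<lambda>x. M *\<^sub>R (indicator (cball 0 R) x *\<^sub>R f x))"
    by (intro integrable_scaleR_right borel_integrable_compact continuous_on_subset[OF f]) auto
  then show ?thesis
  proof (rule Bochner_Integration.integrable_bound)
    have "norm (\<mu> x *\<^sub>R f x) \<le> norm (M *\<^sub>R (indicator (cball 0 R) x *\<^sub>R f x))" for x
      using M[of x] R[of x] by (cases "norm x \<le> R") (auto simp: indicator_def intro!: mult_right_mono)
    then show "AE x in lborel. norm (\<mu> x *\<^sub>R f x) \<le> norm (M *\<^sub>R (indicator (cball 0 R) x *\<^sub>R f x))"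
      by simp
  qed measurable
qed

lemma test_density_diff:
  assumes "test_density R \<mu>" "test_density R \<nu>"
  shows "test_density R (\<lambda>x. \<mu> x - \<nu> x)"
proof -
  obtain A B where "\<And>x. \<bar>\<mu> x\<bar> \<le> A" "\<And>x. \<bar>\<nu> x\<bar> \<le> B"
    using assms unfolding test_density_def by blast
  then have "\<bar>\<mu> x - \<nu> x\<bar> \<le> A + B" for x
    by (meson abs_triangle_ineq4 add_mono order_trans)
  then show ?thesis using assms unfolding test_density_def by auto
qed

lemma test_density_translate:
  assumes "test_density R \<mu>"
  shows "test_density (R + norm h) (\<lambda>x. \<mu> (x - h))"
proof -
  have [measurable]: "\<mu> \<in> borel_measurable borel" by (rule test_density_measurable[OF assms])
  have "R < norm (x - h)" if "R + norm h < norm x" for x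
    using that norm_triangle_sub[of x h] by linarith
  then show ?thesis using assms unfolding test_density_def by auto
qed

lemma integral_lborel_affine:
  fixes f :: "'a::euclidean_space \<Rightarrow> real"
  assumes [measurable]: "f \<in> borel_measurable borel" and "t > 0"
  shows "integral\<^sup>L lborel f = t ^ DIM('a) * (LINT x|lborel. f (a + t *\<^sub>R x))"
  by (subst lborel_affine[of t a]) (use \<open>t > 0\<close> in \<open>simp_all add: integral_density integral_distr\<close>)

lemma integral_pair_affine:
  fixes f :: "'a::euclidean_space \<times> 'a \<Rightarrow> real"
  assumes f: "f \<in> borel_measurable (borel \<Otimes>\<^sub>M borel)" and "t > 0"
  shows "integral\<^sup>L (lborel \<Otimes>\<^sub>M lborel) f
    = t ^ (2 * DIM('a)) * (LINT p|(lborel \<Otimes>\<^sub>M lborel). f (a + t *\<^sub>R fst p, b + t *\<^sub>R snd p))"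
proof -
  have "f \<in> borel_measurable borel" using f by (simp add: borel_prod)
  from integral_lborel_affine[OF this \<open>t > 0\<close>, of "(a, b)"]
  show ?thesis unfolding lborel_prod by (simp add: plus_prod_def mult_2)
qed

lemma interaction_measurable:
  fixes K :: "'a::euclidean_space \<Rightarrow> real"
  assumes [measurable]: "K \<in> borel_measurable borel" "\<mu> \<in> borel_measurable borel" "\<nu> \<in> borel_measurable borel"
  shows "(\<lambda>p. K (fst p - snd p) * (\<mu> (fst p) * \<nu> (snd p))) \<in> borel_measurable (borel \<Otimes>\<^sub>M borel)"
  by measurable

lemma interaction_translate:
  fixes K :: "'a::euclidean_space \<Rightarrow> real"
  assumes "K \<in> borel_measurable borel" "\<mu> \<in> borel_measurable borel" "\<nu> \<in> borel_measurable borel"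
  shows "interaction K (\<lambda>x. \<mu> (h + x)) (\<lambda>x. \<nu> (h + x)) = interaction K \<mu> \<nu>"
  using integral_pair_affine[OF interaction_measurable[OF assms], of 1 h h]
  unfolding interaction_def by simp

lemma interaction_scale:
  fixes K :: "'a::euclidean_space \<Rightarrow> real"
  assumes "K \<in> borel_measurable borel" "\<mu> \<in> borel_measurable borel" "\<nu> \<in> borel_measurable borel"
    and "t > 0" and hom: "\<And>z. K (t *\<^sub>R z) = a * K z"
  shows "interaction K \<mu> \<nu> = t ^ (2 * DIM('a)) * a * interaction K (\<lambda>x. \<mu> (t *\<^sub>R x)) (\<lambda>x. \<nu> (t *\<^sub>R x))"
proof -
  have "K (t *\<^sub>R x - t *\<^sub>R y) = a * K (x - y)" for x y
    by (simp add: hom scaleR_diff_right[symmetric])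
  then show ?thesis
    using integral_pair_affine[OF interaction_measurable[OF assms(1-3)] \<open>t > 0\<close>, of 0 0]
    unfolding interaction_def by (simp add: mult.assoc)
qed

text \<open>For \<open>g(x) = exp (- 2 c |x|\<^sup>2)\<close> the densities \<open>g cos (2 \<pi> k x)\<close> and \<open>g sin (2 \<pi> k x)\<close> are the real
  and imaginary part of a modulated Gaussian. By the addition theorem for the cosine their
  self-interactions sum to the interaction of \<open>g\<close> with itself for the kernel \<open>K(z) cos (2 \<pi> k z)\<close>,
  which is a positive multiple of the given integral. So one of the two self-interactions is
  negative, and it stays negative when the density is cut off outside a large ball.\<close>

lemma exists_test_density_interaction_negative:
  fixes K :: "'a::euclidean_space \<Rightarrow> real"
  assumes K: "gaussian_integrable K" and "0 < c"
    and neg: "(LINT x|lborel. K x * cos (2 * pi * (k \<bullet> x)) * exp (- c * (norm x)\<^sup>2)) < 0"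
  shows "\<exists>R \<mu>. test_density R \<mu> \<and> interaction K \<mu> \<mu> < 0"
proof -
  have Km[measurable]: "K \<in> borel_measurable borel" by (rule gaussian_integrable_measurable[OF K])
  define g where "g x = exp (- (2 * c) * (norm x)\<^sup>2)" for x :: 'a
  define a where "a x = g x * cos (2 * pi * (k \<bullet> x))" for x
  define b where "b x = g x * sin (2 * pi * (k \<bullet> x))" for x
  have [measurable]: "a \<in> borel_measurable borel" "b \<in> borel_measurable borel"
    unfolding a_def b_def g_def by measurable
  have bound: "\<bar>a x\<bar> \<le> 1 * exp (- (2 * c) * (norm x)\<^sup>2)" "\<bar>b x\<bar> \<le> 1 * exp (- (2 * c) * (norm x)\<^sup>2)" for x
    by (simp_all add: a_def b_def g_def abs_mult)
  let ?P = "\<lambda>\<mu> p. K (fst p - snd p) * (\<mu> (fst p) * \<mu> (snd p))"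
  have int: "integrable (lborel \<Otimes>\<^sub>M lborel) (?P a)" "integrable (lborel \<Otimes>\<^sub>M lborel) (?P b)"
    by (rule interaction_integrable[OF K _ _ _ bound(1) bound(1)], use \<open>0 < c\<close> in simp_all)
       (rule interaction_integrable[OF K _ _ _ bound(2) bound(2)], use \<open>0 < c\<close> in simp_all)
  define I where "I = (LINT x|lborel. K x * cos (2 * pi * (k \<bullet> x)) * exp (- c * (norm x)\<^sup>2))"
  have "integrable lborel (\<lambda>x. K x * cos (2 * pi * (k \<bullet> x)) * exp (- c * (norm x)\<^sup>2))"
    by (rule Bochner_Integration.integrable_bound[OF gaussian_integrableD[OF K \<open>0 < c\<close>]])
       (auto simp: abs_mult intro!: mult_right_mono mult_left_le)
  then have I: "has_bochner_integral lborel (\<lambda>x. K x * cos (2 * pi * (k \<bullet> x)) * exp (- c * (norm x)\<^sup>2)) I"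
    by (simp only: has_bochner_integral_iff I_def)
  let ?J = "sqrt (pi / (4 * c)) ^ DIM('a)"
  have "interaction K a a + interaction K b b = (LINT p|(lborel \<Otimes>\<^sub>M lborel). ?P a p + ?P b p)"
    unfolding interaction_def by (rule Bochner_Integration.integral_add[symmetric, OF int])
  also have "\<dots> = (LINT p|(lborel \<Otimes>\<^sub>M lborel). (\<lambda>x. K x * cos (2 * pi * (k \<bullet> x))) (fst p - snd p)
          * (exp (- (2 * c) * (norm (fst p))\<^sup>2) * exp (- (2 * c) * (norm (snd p))\<^sup>2)))"
  proof (rule Bochner_Integration.integral_cong[OF refl])
    fix p :: "'a \<times> 'a"
    have "cos (2 * pi * (k \<bullet> (fst p - snd p))) = cos (2 * pi * (k \<bullet> fst p)) * cos (2 * pi * (k \<bullet> snd p))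
        + sin (2 * pi * (k \<bullet> fst p)) * sin (2 * pi * (k \<bullet> snd p))"
      by (simp only: inner_diff_right right_diff_distrib cos_diff)
    moreover have "z * ((e * c) * (e' * c')) + z * ((e * s) * (e' * s')) = z * (c * c' + s * s') * (e * e')"
      for z e e' c c' s s' :: real by algebra
    ultimately show "?P a p + ?P b p = (\<lambda>x. K x * cos (2 * pi * (k \<bullet> x))) (fst p - snd p)
          * (exp (- (2 * c) * (norm (fst p))\<^sup>2) * exp (- (2 * c) * (norm (snd p))\<^sup>2))"
      by (simp only: a_def b_def g_def)
  qed
  also have "\<dots> = I * ?J"
    by (rule has_bochner_integral_integral_eq, rule gaussian_has_interaction[OF _ I has_bochner_integral_gaussian])
       (use \<open>0 < c\<close> in simp_all)
  also have "\<dots> < 0" using neg \<open>0 < c\<close> by (simp add: I_def mult_less_0_iff)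
  finally have "interaction K a a < 0 \<or> interaction K b b < 0" by linarith
  then obtain w where w: "w \<in> borel_measurable borel"
    and wb: "\<And>x. \<bar>w x\<bar> \<le> 1 * exp (- (2 * c) * (norm x)\<^sup>2)"
    and wint: "integrable (lborel \<Otimes>\<^sub>M lborel) (?P w)" and wneg: "interaction K w w < 0"
  proof (elim disjE)
    assume "interaction K a a < 0"
    with bound(1) int(1) show ?thesis by (intro that[of a]) simp_all
  next
    assume "interaction K b b < 0"
    with bound(2) int(2) show ?thesis by (intro that[of b]) simp_all
  qed
  define w' where "w' n x = indicator (cball 0 (real n)) x * w x" for n x
  have w'm: "w' n \<in> borel_measurable borel" for n
    unfolding w'_def by (intro borel_measurable_times borel_measurable_indicator w) simp
  have "(\<lambda>n. interaction K (w' n) (w' n)) \<longlonglongrightarrow> interaction K w w"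
    unfolding interaction_def
  proof (rule integral_dominated_convergence[where w="\<lambda>p. \<bar>?P w p\<bar>"])
    show "integrable (lborel \<Otimes>\<^sub>M lborel) (\<lambda>p. \<bar>?P w p\<bar>)" using wint by (rule integrable_abs)
    have "(\<lambda>n. ?P (w' n) p) \<longlonglongrightarrow> ?P w p" for p
    proof (rule tendsto_eventually)
      obtain N where N: "norm (fst p) + norm (snd p) \<le> real N" using real_arch_simple by blast
      show "\<forall>\<^sub>F n in sequentially. ?P (w' n) p = ?P w p"
        using eventually_ge_at_top[of N]
      proof eventually_elim
        case (elim n)
        then have "real N \<le> real n" by simp
        then have "norm (fst p) \<le> real n" "norm (snd p) \<le> real n"
          using N norm_ge_zero[of "fst p"] norm_ge_zero[of "snd p"] by linarith+
        then show ?case by (simp add: w'_def)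
      qed
    qed
    then show "AE p in lborel \<Otimes>\<^sub>M lborel. (\<lambda>n. ?P (w' n) p) \<longlonglongrightarrow> ?P w p" by simp
    show "AE p in lborel \<Otimes>\<^sub>M lborel. norm (?P (w' n) p) \<le> \<bar>?P w p\<bar>" for n
      by (rule AE_I2) (simp add: w'_def indicator_def abs_mult)
    show "?P w \<in> borel_measurable (lborel \<Otimes>\<^sub>M lborel)" "?P (w' n) \<in> borel_measurable (lborel \<Otimes>\<^sub>M lborel)" for n
      using interaction_measurable[OF Km w w] interaction_measurable[OF Km w'm w'm]
      by (simp_all cong: measurable_cong_sets)
  qed
  then have "\<forall>\<^sub>F n in sequentially. interaction K (w' n) (w' n) < 0"
    using wneg by (rule order_tendstoD)
  then obtain n where "interaction K (w' n) (w' n) < 0"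
    using eventually_happens'[OF sequentially_bot] by blast
  moreover have "test_density (real n) (w' n)"
  proof -
    have "\<bar>w' n x\<bar> \<le> 1" for x
      using wb[of x] \<open>0 < c\<close> by (auto simp: w'_def indicator_def intro: order_trans)
    then show ?thesis
      unfolding test_density_def using w'm by (auto simp: w'_def)
  qed
  ultimately show ?thesis by blast
qed

text \<open>If \<open>h\<close> is long, then any point of the support of \<open>\<mu>\<close> and any point of the support of its
  translate have a distance at which \<open>K\<close> is small.\<close>

lemma interaction_far_small:
  fixes K :: "'a::euclidean_space \<Rightarrow> real"
  assumes K: "gaussian_integrable K" and \<mu>: "test_density R \<mu>" and "0 < \<delta>"
    and decay: "\<And>\<eta>. 0 < \<eta> \<Longrightarrow> \<exists>r. \<forall>z. r \<le> norm z \<longrightarrow> \<bar>K z\<bar> \<le> \<eta>"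
  shows "\<exists>\<rho>. \<forall>h. \<rho> \<le> norm h \<longrightarrow> \<bar>interaction K \<mu> (\<lambda>x. \<mu> (x - h))\<bar> \<le> \<delta>"
proof -
  define m where "m = (LINT x|lborel. \<bar>\<mu> x\<bar>)"
  have "m \<ge> 0" by (simp add: m_def)
  obtain r where r: "\<And>z. r \<le> norm z \<Longrightarrow> \<bar>K z\<bar> \<le> \<delta> / (m * m + 1)"
    using decay[of "\<delta> / (m * m + 1)"] \<open>0 < \<delta>\<close> by (auto simp: add_nonneg_pos)
  have intm: "integrable lborel \<mu>" using test_density_integrable[OF \<mu>, of "\<lambda>x. 1::real"] by simp
  have R: "\<mu> x = 0" if "R < norm x" for x using \<mu> that by (simp add: test_density_def)
  have "\<bar>interaction K \<mu> (\<lambda>x. \<mu> (x - h))\<bar> \<le> \<delta>" if h: "r + 2 * R \<le> norm h" for h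
  proof -
    let ?\<nu> = "\<lambda>x. \<mu> (x - h)"
    have 1: "has_bochner_integral lborel (\<lambda>x. \<bar>\<mu> x\<bar>) m"
      unfolding m_def using intm by (intro has_bochner_integral_integrable integrable_abs)
    have 2: "has_bochner_integral lborel (\<lambda>x. \<bar>?\<nu> x\<bar>) m"
      using has_bochner_integral_translation[OF 1, of "- h"] by simp
    note B = has_bochner_integral_mult_right[OF has_bochner_integral_pair_mult[OF 1 2], of "\<delta> / (m * m + 1)"]
    have "\<bar>interaction K \<mu> ?\<nu>\<bar> \<le> (LINT p|(lborel \<Otimes>\<^sub>M lborel). \<bar>K (fst p - snd p) * (\<mu> (fst p) * ?\<nu> (snd p))\<bar>)"
      unfolding interaction_def by (rule integral_abs_bound)
    also have "\<dots> \<le> (LINT p|(lborel \<Otimes>\<^sub>M lborel). \<delta> / (m * m + 1) * (\<bar>\<mu> (fst p)\<bar> * \<bar>?\<nu> (snd p)\<bar>))"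
    proof (rule integral_mono)
      show "integrable (lborel \<Otimes>\<^sub>M lborel) (\<lambda>p. \<bar>K (fst p - snd p) * (\<mu> (fst p) * ?\<nu> (snd p))\<bar>)"
        by (intro integrable_abs interaction_integrable_test[OF K \<mu> test_density_translate[OF \<mu>]])
      show "integrable (lborel \<Otimes>\<^sub>M lborel) (\<lambda>p. \<delta> / (m * m + 1) * (\<bar>\<mu> (fst p)\<bar> * \<bar>?\<nu> (snd p)\<bar>))"
        using B by (simp only: has_bochner_integral_iff)
      fix p :: "'a \<times> 'a"
      show "\<bar>K (fst p - snd p) * (\<mu> (fst p) * ?\<nu> (snd p))\<bar> \<le> \<delta> / (m * m + 1) * (\<bar>\<mu> (fst p)\<bar> * \<bar>?\<nu> (snd p)\<bar>)"
      proof (cases "norm (fst p) \<le> R \<and> norm (snd p - h) \<le> R")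
        case True
        have "norm h \<le> norm (h - (snd p - fst p)) + norm (snd p - fst p)"
          by (metis norm_triangle_sub add.commute)
        also have "norm (h - (snd p - fst p)) \<le> norm (fst p) + norm (snd p - h)"
          using norm_triangle_ineq4[of "fst p" "snd p - h"] by (simp add: algebra_simps)
        finally have "r \<le> norm (fst p - snd p)" using h True by (simp add: norm_minus_commute)
        then show ?thesis unfolding abs_mult by (intro mult_right_mono r mult_nonneg_nonneg abs_ge_zero)
      next
        case False
        then have "\<mu> (fst p) * ?\<nu> (snd p) = 0" using R[of "fst p"] R[of "snd p - h"] by auto
        then show ?thesis by auto
      qed
    qed
    also have "\<dots> = \<delta> / (m * m + 1) * (m * m)"
      using B by (simp only: has_bochner_integral_iff)
    also have "\<dots> \<le> \<delta>"
    proof -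
      have "m * m / (m * m + 1) \<le> 1" by (simp add: add_nonneg_pos)
      then show ?thesis using mult_left_mono[of _ 1 \<delta>] \<open>0 < \<delta>\<close> by fastforce
    qed
    finally show ?thesis .
  qed
  then show ?thesis by blast
qed

text \<open>Subtracting from \<open>\<mu>\<close> a translate by a long vector makes the total mass vanish. The two copies
  contribute the same negative self-interaction, and their mutual interaction is negligible because
  \<open>K\<close> decays at infinity.\<close>

lemma exists_neutral_test_density_interaction_negative:
  fixes K :: "'a::euclidean_space \<Rightarrow> real"
  assumes K: "gaussian_integrable K" and \<mu>: "test_density R \<mu>" and neg: "interaction K \<mu> \<mu> < 0"
    and decay: "\<And>\<eta>. 0 < \<eta> \<Longrightarrow> \<exists>r. \<forall>z. r \<le> norm z \<longrightarrow> \<bar>K z\<bar> \<le> \<eta>"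
  shows "\<exists>R \<mu>. test_density R \<mu> \<and> integral\<^sup>L lborel \<mu> = 0 \<and> interaction K \<mu> \<mu> < 0"
proof -
  define \<delta> where "\<delta> = - interaction K \<mu> \<mu> / 2"
  have "0 < \<delta>" using neg by (simp add: \<delta>_def)
  obtain \<rho> where \<rho>: "\<And>h. \<rho> \<le> norm h \<Longrightarrow> \<bar>interaction K \<mu> (\<lambda>x. \<mu> (x - h))\<bar> \<le> \<delta>"
    using interaction_far_small[OF K \<mu> \<open>0 < \<delta>\<close> decay] by blast
  obtain h :: 'a where h: "\<rho> \<le> norm h"
  proof -
    obtain e :: 'a where "e \<in> Basis" using nonempty_Basis by blast
    then have "norm (\<bar>\<rho>\<bar> *\<^sub>R e) = \<bar>\<rho>\<bar>" by (simp add: norm_Basis)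
    then show ?thesis by (intro that[of "\<bar>\<rho>\<bar> *\<^sub>R e"]) (simp only: abs_ge_self)
  qed
  let ?\<nu> = "\<lambda>x. \<mu> (x - h)"
  have \<nu>: "test_density (R + norm h) ?\<nu>" by (rule test_density_translate[OF \<mu>])
  note m = gaussian_integrable_measurable[OF K] test_density_measurable[OF \<mu>] test_density_measurable[OF \<nu>]
  have "interaction K ?\<nu> ?\<nu> = interaction K \<mu> \<mu>"
    using interaction_translate[OF m(1,2,2), of "- h"] by simp
  moreover have "interaction K ?\<nu> \<mu> = interaction K \<mu> (\<lambda>x. \<mu> (x - (- h)))"
    using interaction_translate[OF m(1,3,2), of h] by (simp add: add.commute)
  then have "\<bar>interaction K ?\<nu> \<mu>\<bar> \<le> \<delta>" using \<rho>[of "- h"] h by simp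
  moreover have "\<bar>interaction K \<mu> ?\<nu>\<bar> \<le> \<delta>" using \<rho> h by blast
  moreover have "interaction K (\<lambda>x. \<mu> x - ?\<nu> x) (\<lambda>x. \<mu> x - ?\<nu> x)
      = (interaction K \<mu> \<mu> - interaction K \<mu> ?\<nu>) - (interaction K ?\<nu> \<mu> - interaction K ?\<nu> ?\<nu>)"
  proof -
    let ?P = "\<lambda>\<alpha> \<beta> p. K (fst p - snd p) * (\<alpha> (fst p) * \<beta> (snd p))"
    note i = interaction_integrable_test[OF K \<mu> \<mu>] interaction_integrable_test[OF K \<mu> \<nu>]
      interaction_integrable_test[OF K \<nu> \<mu>] interaction_integrable_test[OF K \<nu> \<nu>]
    have "?P (\<lambda>x. \<mu> x - ?\<nu> x) (\<lambda>x. \<mu> x - ?\<nu> x) = (\<lambda>p. (?P \<mu> \<mu> p - ?P \<mu> ?\<nu> p) - (?P ?\<nu> \<mu> p - ?P ?\<nu> ?\<nu> p))"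
      by (rule ext) (simp add: algebra_simps)
    then show ?thesis
      unfolding interaction_def
      by (simp only: Bochner_Integration.integral_diff Bochner_Integration.integrable_diff i)
  qed
  ultimately have "interaction K (\<lambda>x. \<mu> x - ?\<nu> x) (\<lambda>x. \<mu> x - ?\<nu> x) < 0"
    using \<open>0 < \<delta>\<close> unfolding \<delta>_def by argo
  moreover have "(LINT x|lborel. \<mu> x - ?\<nu> x) = 0"
  proof -
    have "has_bochner_integral lborel \<mu> (integral\<^sup>L lborel \<mu>)"
      using test_density_integrable[OF \<mu>, of "\<lambda>x. 1::real"] by (simp add: has_bochner_integral_integrable)
    from has_bochner_integral_diff[OF this has_bochner_integral_translation[OF this, of "- h"]]
    show ?thesis by (simp add: has_bochner_integral_iff)
  qed
  moreover have "test_density (R + norm h) (\<lambda>x. \<mu> x - ?\<nu> x)"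
    by (rule test_density_diff[OF test_density_mono[OF \<mu>] \<nu>]) simp
  ultimately show ?thesis by blast
qed

section \<open>The quadratic confinement and the energy\<close>

lemma gaussian_integrable_norm_square:
  "gaussian_integrable (\<lambda>z::'a::euclidean_space. (norm z)\<^sup>2)"
  unfolding gaussian_integrable_def
proof (intro allI impI)
  fix c :: real assume "0 < c"
  have "integrable lborel (\<lambda>z::'a. 2 / c * exp (- (c / 2) * (norm z)\<^sup>2))"
    using has_bochner_integral_gaussian[of "c / 2", where 'a='a] \<open>0 < c\<close>
    by (intro integrable_mult_right) (auto simp: has_bochner_integral_iff)
  then show "integrable lborel (\<lambda>z::'a. (norm z)\<^sup>2 * exp (- c * (norm z)\<^sup>2))"
  proof (rule Bochner_Integration.integrable_bound)
    have "norm ((norm z)\<^sup>2 * exp (- c * (norm z)\<^sup>2)) \<le> norm (2 / c * exp (- (c / 2) * (norm z)\<^sup>2))" for z :: 'a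
    proof -
      have "c / 2 * (norm z)\<^sup>2 \<le> exp (c / 2 * (norm z)\<^sup>2)"
        using exp_ge_add_one_self[of "c / 2 * (norm z)\<^sup>2"] by linarith
      then have "(norm z)\<^sup>2 \<le> 2 / c * exp (c / 2 * (norm z)\<^sup>2)"
        using \<open>0 < c\<close> by (simp add: field_simps)
      then have "(norm z)\<^sup>2 * exp (- c * (norm z)\<^sup>2) \<le> 2 / c * exp (c / 2 * (norm z)\<^sup>2) * exp (- c * (norm z)\<^sup>2)"
        by (rule mult_right_mono) simp
      also have "\<dots> = 2 / c * exp (- (c / 2) * (norm z)\<^sup>2)"
        by (simp add: mult.assoc mult_exp_exp)
      finally show ?thesis using \<open>0 < c\<close> by simp
    qed
    then show "AE z::'a in lborel. norm ((norm z)\<^sup>2 * exp (- c * (norm z)\<^sup>2)) \<le> norm (2 / c * exp (- (c / 2) * (norm z)\<^sup>2))"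
      by simp
  qed measurable
qed

lemma gaussian_integrable_add:
  assumes "gaussian_integrable K" "gaussian_integrable L"
  shows "gaussian_integrable (\<lambda>z. K z + L z)"
  unfolding gaussian_integrable_def distrib_right
  by (intro allI impI Bochner_Integration.integrable_add gaussian_integrableD assms)

text \<open>Expand \<open>|x - y|\<^sup>2 = |x|\<^sup>2 - 2 x y + |y|\<^sup>2\<close>. If the total mass vanishes, only the mixed term
  survives; it equals \<open>- 2 |m|\<^sup>2\<close> for the first moment \<open>m\<close> of \<open>\<mu>\<close>.\<close>

lemma interaction_norm_square_nonpos:
  fixes \<mu> :: "'a::euclidean_space \<Rightarrow> real"
  assumes \<mu>: "test_density R \<mu>" and neutral: "integral\<^sup>L lborel \<mu> = 0"
  shows "interaction (\<lambda>z. (norm z)\<^sup>2) \<mu> \<mu> \<le> 0"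
proof -
  define m where "m = (LINT y|lborel. \<mu> y *\<^sub>R y)"
  define q where "q = (LINT y|lborel. \<mu> y * (norm y)\<^sup>2)"
  have i: "integrable lborel \<mu>" "integrable lborel (\<lambda>y. \<mu> y * (norm y)\<^sup>2)" "integrable lborel (\<lambda>y. \<mu> y *\<^sub>R y)"
    using test_density_integrable[OF \<mu>, of "\<lambda>x. 1::real"] test_density_integrable[OF \<mu>, of "\<lambda>x. (norm x)\<^sup>2"]
      test_density_integrable[OF \<mu>, of "\<lambda>x. x"]
    by (auto intro: continuous_intros)
  have zero: "has_bochner_integral lborel \<mu> 0"
    using i(1) neutral by (simp only: has_bochner_integral_iff)
  have quad: "has_bochner_integral lborel (\<lambda>y. \<mu> y * (norm y)\<^sup>2) q"
    unfolding q_def by (rule has_bochner_integral_integrable[OF i(2)])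
  have inner: "has_bochner_integral lborel (\<lambda>y. \<mu> y * (x \<bullet> y)) (x \<bullet> m)" for x
  proof -
    have "has_bochner_integral lborel (\<lambda>y. x \<bullet> (\<mu> y *\<^sub>R y)) (x \<bullet> m)"
      unfolding m_def by (intro has_bochner_integral_inner_right has_bochner_integral_integrable i)
    then show ?thesis by simp
  qed
  have "interaction (\<lambda>z. (norm z)\<^sup>2) \<mu> \<mu> = (LINT x|lborel. LINT y|lborel. (norm (x - y))\<^sup>2 * (\<mu> x * \<mu> y))"
    unfolding interaction_def
    using lborel_pair.integral_fst'[OF interaction_integrable_test[OF gaussian_integrable_norm_square \<mu> \<mu>]]
    by simp
  also have "\<dots> = (LINT x|lborel. \<mu> x * q - 2 * (\<mu> x * (m \<bullet> x)))"
  proof (rule Bochner_Integration.integral_cong[OF refl])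
    fix x
    have "has_bochner_integral lborel
        (\<lambda>y. \<mu> x * (norm x)\<^sup>2 * \<mu> y + \<mu> x * (\<mu> y * (norm y)\<^sup>2) - 2 * \<mu> x * (\<mu> y * (x \<bullet> y)))
        (\<mu> x * (norm x)\<^sup>2 * 0 + \<mu> x * q - 2 * \<mu> x * (x \<bullet> m))"
      by (rule has_bochner_integral_diff[OF has_bochner_integral_add[OF
            has_bochner_integral_mult_right[OF zero] has_bochner_integral_mult_right[OF quad]]
            has_bochner_integral_mult_right[OF inner]])
    moreover have "\<mu> x * (norm x)\<^sup>2 * \<mu> y + \<mu> x * (\<mu> y * (norm y)\<^sup>2) - 2 * \<mu> x * (\<mu> y * (x \<bullet> y))
        = (norm (x - y))\<^sup>2 * (\<mu> x * \<mu> y)" for y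
      unfolding power2_norm_eq_inner by (simp add: inner_simps inner_commute algebra_simps)
    ultimately have "has_bochner_integral lborel (\<lambda>y. (norm (x - y))\<^sup>2 * (\<mu> x * \<mu> y))
        (\<mu> x * q - 2 * (\<mu> x * (m \<bullet> x)))"
      by (simp add: inner_commute mult.assoc)
    then show "(LINT y|lborel. (norm (x - y))\<^sup>2 * (\<mu> x * \<mu> y)) = \<mu> x * q - 2 * (\<mu> x * (m \<bullet> x))"
      by (rule has_bochner_integral_integral_eq)
  qed
  also have "\<dots> = - 2 * (m \<bullet> m)"
  proof -
    have "has_bochner_integral lborel (\<lambda>x. \<mu> x * q - 2 * (\<mu> x * (m \<bullet> x))) (0 * q - 2 * (m \<bullet> m))"
      by (rule has_bochner_integral_diff[OF has_bochner_integral_mult_left[OF zero]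
            has_bochner_integral_mult_right[OF inner]])
    from has_bochner_integral_integral_eq[OF this] show ?thesis by simp
  qed
  finally show ?thesis by simp
qed

lemma energy_eq_interaction:
  assumes "gaussian_integrable W" "test_density R \<mu>"
  shows "energy W \<mu> = 1 / 2 * interaction W \<mu> \<mu>"
proof -
  have "W (x - y) * (\<mu> x * \<mu> y) = W (x - y) * \<mu> y * \<mu> x" for x y
    by (simp only: mult_ac)
  then have "(LINT x|lborel. (LINT y|lborel. W (x - y) * \<mu> y) * \<mu> x)
      = (LINT x|lborel. LINT y|lborel. W (x - y) * (\<mu> x * \<mu> y))"
    by (simp only: integral_mult_left_zero)
  also have "\<dots> = interaction W \<mu> \<mu>"
    using lborel_pair.integral_fst'[OF interaction_integrable_test[OF assms(1,2,2)]]
    by (simp add: interaction_def)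
  finally show ?thesis by (simp add: energy_def)
qed

text \<open>Homogeneity of \<open>K\<close> allows one neutral density of negative interaction to be squeezed into any
  ball without changing the sign of the interaction, and the quadratic part cannot increase the
  energy of a neutral density.\<close>

lemma infinitesimal_concave_homogeneous_plus_square:
  fixes K :: "real ^ 2 \<Rightarrow> real"
  assumes K: "gaussian_integrable K" and hom: "\<And>t z. 0 < t \<Longrightarrow> K (t *\<^sub>R z) = a t * K z" and "\<And>t. 0 < t \<Longrightarrow> 0 < a t"
    and \<mu>: "test_density R \<mu>" and neutral: "integral\<^sup>L lborel \<mu> = 0" and neg: "interaction K \<mu> \<mu> < 0"
  shows "infinitesimal_concave (\<lambda>z. K z + (norm z)\<^sup>2)"
  unfolding infinitesimal_concave_def
proof (intro allI impI)
  fix \<epsilon> :: real assume "0 < \<epsilon>"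
  \<comment> \<open>This factor maps the sphere of radius \<open>\<epsilon> / 2\<close> to one of radius \<open>\<bar>R\<bar> + 1\<close>. The support thus
    lies in the closed ball of radius \<open>\<epsilon> / 2\<close>, so that its closure lies in the open ball of
    radius \<open>\<epsilon>\<close>.\<close>
  define t where "t = 2 * (\<bar>R\<bar> + 1) / \<epsilon>"
  have "t > 0" using \<open>0 < \<epsilon>\<close> by (simp add: t_def)
  define \<nu> where "\<nu> x = \<mu> (t *\<^sub>R x)" for x
  have m[measurable]: "\<mu> \<in> borel_measurable borel" by (rule test_density_measurable[OF \<mu>])
  have supp: "\<nu> x = 0" if "\<epsilon> / 2 < norm x" for x
  proof -
    have "\<bar>R\<bar> + 1 = t * (\<epsilon> / 2)" using \<open>0 < \<epsilon>\<close> by (simp add: t_def)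
    also have "\<dots> < t * norm x" using that \<open>t > 0\<close> by simp
    finally have "R < norm (t *\<^sub>R x)" using \<open>t > 0\<close> by simp
    then show ?thesis using \<mu> by (simp add: \<nu>_def test_density_def)
  qed
  have "\<nu> \<in> borel_measurable borel" unfolding \<nu>_def[abs_def] by measurable
  moreover have "\<exists>M. \<forall>x. \<bar>\<nu> x\<bar> \<le> M"
    using \<mu> unfolding test_density_def \<nu>_def by blast
  ultimately have \<nu>: "test_density (\<epsilon> / 2) \<nu>"
    using supp unfolding test_density_def by blast
  have \<nu>0: "integral\<^sup>L lborel \<nu> = 0"
    using integral_lborel_affine[OF m \<open>t > 0\<close>, of 0] neutral \<open>t > 0\<close> by (simp add: \<nu>_def[abs_def])
  have "interaction K \<nu> \<nu> < 0"
  proof -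
    have "0 < t ^ (2 * DIM(real ^ 2)) * a t" using \<open>t > 0\<close> assms(3) by simp
    from mult_nonneg_nonneg[OF less_imp_le[OF this], of "interaction K \<nu> \<nu>"]
    show ?thesis
      using neg interaction_scale[OF gaussian_integrable_measurable[OF K] m m \<open>t > 0\<close> hom[OF \<open>t > 0\<close>]]
      unfolding \<nu>_def[symmetric] by linarith
  qed
  moreover have "interaction (\<lambda>z. (norm z)\<^sup>2) \<nu> \<nu> \<le> 0"
    by (rule interaction_norm_square_nonpos[OF \<nu> \<nu>0])
  moreover have "interaction (\<lambda>z. K z + (norm z)\<^sup>2) \<nu> \<nu> = interaction K \<nu> \<nu> + interaction (\<lambda>z. (norm z)\<^sup>2) \<nu> \<nu>"
    unfolding interaction_def distrib_right
    by (intro Bochner_Integration.integral_add interaction_integrable_test[OF _ \<nu> \<nu>] K gaussian_integrable_norm_square)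
  ultimately have "energy (\<lambda>z. K z + (norm z)\<^sup>2) \<nu> < 0"
    using energy_eq_interaction[OF gaussian_integrable_add[OF K gaussian_integrable_norm_square] \<nu>] by simp
  moreover have "L_infinity \<nu>"
    using \<nu> unfolding L_infinity_def test_density_def by auto
  moreover have "closure {x. \<nu> x \<noteq> 0} \<subseteq> cball 0 (\<epsilon> / 2)"
    using supp by (intro closure_minimal) (auto simp: not_less[symmetric])
  then have "closure {x. \<nu> x \<noteq> 0} \<subseteq> ball 0 \<epsilon>"
    using \<open>0 < \<epsilon>\<close> by (auto simp: subset_iff)
  ultimately show "\<exists>\<mu>. L_infinity \<mu> \<and> (LINT x|lborel. \<mu> x) = 0 \<and>
        closure {x. \<mu> x \<noteq> 0} \<subseteq> ball 0 \<epsilon> \<and> energy (\<lambda>z. K z + (norm z)\<^sup>2) \<mu> < 0"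
    using \<nu>0 by blast
qed

section \<open>Homogeneous functions in the plane\<close>

lemma homogeneous_scaleR:
  assumes "0 < t"
  shows "homogeneous r \<Omega> (t *\<^sub>R z) = t powr r * homogeneous r \<Omega> z"
proof -
  have "Complex (t * z $ 1) (t * z $ 2) = of_real t * Complex (z $ 1) (z $ 2)"
    by (simp add: complex_eq_iff)
  then have "angle (t *\<^sub>R z) = angle z" using assms by (simp add: angle_def)
  then show ?thesis using assms by (simp add: homogeneous_def powr_mult)
qed

lemma homogeneous_decay:
  assumes "0 < s" and \<Omega>: "continuous_on UNIV \<Omega>" and "0 < \<eta>"
  shows "\<exists>r. \<forall>z. r \<le> norm z \<longrightarrow> \<bar>homogeneous (- s) \<Omega> z\<bar> \<le> \<eta>"
proof -
  have "bounded (\<Omega> ` {- pi..pi})"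
    by (intro compact_imp_bounded compact_continuous_image continuous_on_subset[OF \<Omega>]) auto
  then obtain M where M: "\<And>\<theta>. \<theta> \<in> {- pi..pi} \<Longrightarrow> \<bar>\<Omega> \<theta>\<bar> \<le> M"
    unfolding bounded_iff by (metis imageI real_norm_def)
  have "((\<lambda>x. M * x powr (- s)) \<longlongrightarrow> M * 0) at_top"
    using \<open>0 < s\<close> by (intro tendsto_mult_left tendsto_neg_powr filterlim_ident) auto
  then have "\<forall>\<^sub>F x in at_top. M * x powr (- s) < \<eta>"
    using \<open>0 < \<eta>\<close> by (intro order_tendstoD(2)) auto
  then obtain r where r: "\<And>x. r \<le> x \<Longrightarrow> M * x powr (- s) < \<eta>"
    unfolding eventually_at_top_linorder by blast
  have "\<bar>homogeneous (- s) \<Omega> z\<bar> \<le> M * norm z powr (- s)" for z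
  proof -
    have "angle z \<in> {- pi..pi}"
      using Arg_bounded[of "Complex (z $ 1) (z $ 2)"] by (simp add: angle_def)
    from mult_right_mono[OF M[OF this], of "norm z powr (- s)"]
    show ?thesis by (simp add: homogeneous_def abs_mult mult.commute)
  qed
  moreover have "\<exists>r. \<forall>z::real^2. r \<le> norm z \<longrightarrow> M * norm z powr (- s) \<le> \<eta>"
    using r by (blast intro: less_imp_le)
  ultimately show ?thesis by (blast intro: order_trans)
qed

text \<open>The function \<open>angle\<close> jumps across the negative half-axis. Since \<open>\<Omega>\<close> is continuous and periodic, it
  is also negative at some angle strictly between \<open>- \<pi>\<close> and \<open>\<pi>\<close>; the point of the unit circle at that
  angle avoids both the jump and the origin.\<close>

lemma exists_continuity_point_homogeneous_negative:
  assumes cont: "continuous_on UNIV \<Omega>" and per: "\<And>\<phi>. \<Omega> (\<phi> + 2 * pi) = \<Omega> \<phi>" and neg: "\<Omega> \<phi> < 0"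
  shows "\<exists>k. isCont (homogeneous r \<Omega>) k \<and> homogeneous r \<Omega> k < 0"
proof -
  have "\<exists>\<psi>\<in>{- pi<..<pi}. \<Omega> \<psi> < 0"
  proof -
    have shift: "\<Omega> (x + 2 * pi * real_of_int n) = \<Omega> x" for x n
    proof (induction n rule: int_induct[of _ 0])
      case (step1 i)
      then show ?case using per[of "x + 2 * pi * real_of_int i"] by (simp add: algebra_simps)
    next
      case (step2 i)
      then show ?case using per[of "x + 2 * pi * real_of_int (i - 1)"] by (simp add: algebra_simps)
    qed simp
    define n where "n = \<lfloor>(\<phi> + pi) / (2 * pi)\<rfloor>"
    define \<psi> where "\<psi> = \<phi> + 2 * pi * real_of_int (- n)"
    have "real_of_int n \<le> (\<phi> + pi) / (2 * pi)" "(\<phi> + pi) / (2 * pi) < real_of_int n + 1"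
      unfolding n_def by linarith+
    then have "- pi \<le> \<psi>" "\<psi> < pi" by (simp_all add: \<psi>_def field_simps)
    have "\<Omega> \<psi> < 0" unfolding \<psi>_def shift by (rule neg)
    have "isCont \<Omega> \<psi>" using cont by (simp add: continuous_on_eq_continuous_at)
    then have "\<forall>\<^sub>F x in nhds \<psi>. \<Omega> x < 0"
      using \<open>\<Omega> \<psi> < 0\<close> unfolding isCont_def tendsto_at_iff_tendsto_nhds by (rule order_tendstoD)
    then obtain d where d: "d > 0" "\<And>x. dist x \<psi> < d \<Longrightarrow> \<Omega> x < 0"
      unfolding eventually_nhds_metric by blast
    obtain x where x: "\<psi> < x" "x < min pi (\<psi> + d)"
      using dense[of \<psi> "min pi (\<psi> + d)"] d(1) \<open>\<psi> < pi\<close> by auto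
    then have "x < pi" "dist x \<psi> < d" by (auto simp: dist_real_def)
    with d(2) x \<open>- pi \<le> \<psi>\<close> show ?thesis by (intro bexI[of _ x]) auto
  qed
  then obtain \<psi> where \<psi>: "- pi < \<psi>" "\<psi> < pi" "\<Omega> \<psi> < 0" by auto
  define k :: "real ^ 2" where "k = vector [cos \<psi>, sin \<psi>]"
  have kc: "Complex (k $ 1) (k $ 2) = cis \<psi>" by (simp add: k_def complex_eq_iff)
  have ang: "angle k = \<psi>"
    unfolding angle_def kc using \<psi> by (intro cis_Arg_unique) (auto simp: sgn_div_norm)
  have "k \<noteq> 0"
  proof
    assume "k = 0"
    then have "cis \<psi> = 0" using kc by (simp add: zero_complex.code)
    then show False by simp
  qed
  have "cis \<psi> \<notin> \<real>\<^sub>\<le>\<^sub>0"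
  proof
    assume "cis \<psi> \<in> \<real>\<^sub>\<le>\<^sub>0"
    then have "cos \<psi> \<le> 0" "sin \<psi> = 0" by (auto simp: complex_nonpos_Reals_iff)
    moreover from this have "cos \<psi> \<noteq> 0" using sin_cos_squared_add[of \<psi>] by auto
    ultimately have "Arg (cis \<psi>) = pi" by (simp add: Arg_eq_pi)
    then show False using ang \<psi> by (simp add: angle_def kc)
  qed
  then have "isCont Arg (Complex (k $ 1) (k $ 2))" unfolding kc by (rule continuous_at_Arg)
  moreover have "isCont (\<lambda>x::real^2. Complex (x $ 1) (x $ 2)) k"
    unfolding Complex_eq by (intro continuous_intros)
  ultimately have "isCont angle k"
    unfolding angle_def[abs_def] by (rule isCont_o2[rotated])
  moreover have "isCont \<Omega> (angle k)" using cont by (simp add: continuous_on_eq_continuous_at)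
  ultimately have "isCont (\<lambda>x. \<Omega> (angle x)) k" by (rule isCont_o2)
  then have "isCont (homogeneous r \<Omega>) k"
    unfolding homogeneous_def[abs_def] using \<open>k \<noteq> 0\<close> by (intro continuous_intros) auto
  moreover have "homogeneous r \<Omega> k < 0"
    using \<psi>(3) \<open>k \<noteq> 0\<close> by (simp add: homogeneous_def ang mult_less_0_iff)
  ultimately show ?thesis by blast
qed

section \<open>Infinitesimal concavity\<close>

theorem proposition2p5:
  fixes s :: real and \<Omega> \<Omega>t :: "real \<Rightarrow> real"
  assumes "0 < s" and "s < 2"
    and "smooth \<Omega>"
    and "\<And>\<theta>. 0 < \<Omega> \<theta>"
    and "\<And>\<theta>. \<Omega> (\<theta> + pi) = \<Omega> \<theta>"
    and "angular_fourier s \<Omega> \<Omega>t"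
    and "\<exists>\<phi>. \<Omega>t \<phi> < 0"
  shows "infinitesimal_concave (potential s \<Omega>)"
proof -
  let ?K = "homogeneous (- s) \<Omega>"
  have F: "has_distr_fourier (\<lambda>x. complex_of_real (?K x)) (\<lambda>\<xi>. complex_of_real (homogeneous (- 2 + s) \<Omega>t \<xi>))"
    and \<Omega>t: "continuous_on UNIV \<Omega>t" "\<And>\<phi>. \<Omega>t (\<phi> + 2 * pi) = \<Omega>t \<phi>"
    using \<open>angular_fourier s \<Omega> \<Omega>t\<close> by (simp_all add: angular_fourier_def)
  have "iter_deriv [] \<Omega> differentiable at x" for x
    using \<open>smooth \<Omega>\<close> unfolding smooth_def by (metis empty_set empty_subsetI)
  then have \<Omega>: "continuous_on UNIV \<Omega>"
    by (auto simp: iter_deriv_def continuous_on_eq_continuous_at intro: differentiable_imp_continuous_within)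
  have K: "gaussian_integrable ?K"
    unfolding gaussian_integrable_def
  proof (intro allI impI)
    fix c :: real assume "0 < c"
    have "integrable lborel (\<lambda>x. complex_of_real (?K x) * complex_of_real (exp (- c * (norm (x - 0))\<^sup>2)))"
      using F schwartz_gaussian[OF \<open>0 < c\<close>] unfolding has_distr_fourier_def tempered_def by blast
    then show "integrable lborel (\<lambda>z. ?K z * exp (- c * (norm z)\<^sup>2))"
      by (simp only: of_real_mult[symmetric] complex_of_real_integrable_eq diff_zero)
  qed
  have decay: "\<exists>r. \<forall>z. r \<le> norm z \<longrightarrow> \<bar>?K z\<bar> \<le> \<eta>" if "0 < \<eta>" for \<eta>
    by (rule homogeneous_decay[OF \<open>0 < s\<close> \<Omega> that])
  obtain k where "isCont (homogeneous (- 2 + s) \<Omega>t) k" "homogeneous (- 2 + s) \<Omega>t k < 0"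
    using exists_continuity_point_homogeneous_negative[OF \<Omega>t] \<open>\<exists>\<phi>. \<Omega>t \<phi> < 0\<close> by blast
  then obtain c where "0 < c" "(LINT x|lborel. ?K x * cos (2 * pi * (k \<bullet> x)) * exp (- c * (norm x)\<^sup>2)) < 0"
    using modulated_gaussian_negative[OF F] by blast
  then obtain R \<mu> where "test_density R \<mu>" "interaction ?K \<mu> \<mu> < 0"
    using exists_test_density_interaction_negative[OF K] by blast
  then obtain R \<nu> where "test_density R \<nu>" "integral\<^sup>L lborel \<nu> = 0" "interaction ?K \<nu> \<nu> < 0"
    using exists_neutral_test_density_interaction_negative[OF K _ _ decay] by blast
  then have "infinitesimal_concave (\<lambda>z. ?K z + (norm z)\<^sup>2)"
    by (rule infinitesimal_concave_homogeneous_plus_square[OF K homogeneous_scaleR, rotated -3]) simp_all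
  then show ?thesis by (simp add: potential_def[abs_def])
qed

end
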